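(* 1. Let $\{f_{n}\}$ be a sequence of nonnegative (not necessarily Boolean) functions $f_n:\{-1,1\}^n\to\mathbb{R}$ with bounded $L^{2}$-norm, i.e., $\limsup_{n\to\infty}\mathbb{E}[f_{n}^{2}(\mathbf{X})]<\infty$ with $\mathbf{X}\sim\mathrm{Unif}\{-1,1\}^{n}$. Let $\delta>0$. Given $n$, let $r\in\mathbb{N}$ such that $\beta:=r/n\in[\delta,1/2-\delta]$. Then, for even $r$, \begin{align*} \mathbf{Stab}_{\beta}[f_{n}]+o_{n}(1)\leq\mathbf{SStab}_{r}[f_{n}] & \leq2\mathbf{Stab}_{\beta}[f_{n}]+o_{n}(1),\\ \mathbf{Stab}_{\beta}[f_{n}]+o_{n}(1)\leq\mathbf{BStab}_{r}[f_{n}] & \leq2(1-\beta)\mathbf{Stab}_{\beta}[f_{n}]+o_{n}(1), \end{align*} and for odd $r$, \begin{align*} 0\leq\mathbf{SStab}_{r}[f_{n}] & \leq\mathbf{Stab}_{\beta}[f_{n}]+o_{n}(1),\\ 2\beta\mathbf{Stab}_{\beta}[f_{n}]+o_{n}(1)\leq\mathbf{BStab}_{r}[f_{n}] & \leq\mathbf{Stab}_{\beta}[f_{n}]+o_{n}(1). \end{align*} Here, the terms $o_{n}(1)$ in these four inequalities are independent of $r$ (given $n$), but dependent on $\delta$. 2. Any sequence of nonnegative functions $f_{n}$ supported on a subset of $\{\mathbf{x}:d_{\mathrm{H}}(\mathbf{x},\mathbf{1})\textrm{ is even}\}$ (or of $\{\mathbf{x}:d_{\mathrm{H}}(\mathbf{x},\mathbf{1})\textrm{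 is odd}\}$) attains (asymptotically, i.e., with equality up to $o_n(1)$) the upper bounds $\mathbf{SStab}_{r}[f_{n}]\leq2\mathbf{Stab}_{\beta}[f_{n}]+o_{n}(1)$ and $\mathbf{BStab}_{r}[f_{n}]\leq2(1-\beta)\mathbf{Stab}_{\beta}[f_{n}]+o_{n}(1)$ for even $r$, and the lower bounds $0\leq\mathbf{SStab}_{r}[f_{n}]$ and $2\beta\mathbf{Stab}_{\beta}[f_{n}]+o_{n}(1)\leq\mathbf{BStab}_{r}[f_{n}]$ for odd $r$. 3. Any Fourier-weight stable sequence of nonnegative functions $f_{n}$ (e.g., indicators of Hamming subcubes or Hamming balls) attains (asymptotically, i.e., with equality up to $o_n(1)$) the lower bounds $\mathbf{Stab}_{\beta}[f_{n}]+o_{n}(1)\leq\mathbf{SStab}_{r}[f_{n}]$ and $\mathbf{Stab}_{\beta}[f_{n}]+o_{n}(1)\leq\mathbf{BStab}_{r}[f_{n}]$ for even $r$, and the upper bounds $\mathbf{SStab}_{r}[f_{n}]\leq\mathbf{Stab}_{\beta}[f_{n}]+o_{n}(1)$ and $\mathbf{BStab}_{r}[f_{n}]\leq\mathbf{Stab}_{\beta}[f_{n}]+o_{n}(1)$ for odd $r$.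
   Context: Let $\mathbf{X}\sim\mathrm{Unif}\{-1,1\}^{n}$ and $\mathbf{Y}=\mathbf{X}\circ\mathbf{Z}$ (coordinatewise product), with $\mathbf{Z}$ independent of $\mathbf{X}$. $d_{\mathrm{H}}$ is the Hamming distance and $\mathbf{1}=(1,\dots,1)$. Let $S_r=\{\mathbf{x}:d_{\mathrm{H}}(\mathbf{x},\mathbf{1})=r\}$ and $B_r=\{\mathbf{x}:d_{\mathrm{H}}(\mathbf{x},\mathbf{1})\le r\}$. For $f:\{-1,1\}^n\to\mathbb{R}$: the sphere-noise stability is $\mathbf{SStab}_{r}[f]:=\mathbb{E}[f(\mathbf{X})f(\mathbf{Y})]$ with $\mathbf{Z}\sim\mathrm{Unif}(S_{r})$; the ball-noise stability is $\mathbf{BStab}_{r}[f]:=\mathbb{E}[f(\mathbf{X})f(\mathbf{Y})]$ with $\mathbf{Z}\sim\mathrm{Unif}(B_{r})$; the (i.i.d.) noise stability is $\mathbf{Stab}_{\beta}[f]:=\mathbb{E}[f(\mathbf{X})f(\mathbf{Y})]$ with $\mathbf{Z}$ having i.i.d. coordinates equal to $-1$ with probability $\beta$ and $1$ with probability $1-\beta$. Fourier coefficients: $\hat f_S=\mathbb{E}[f(\mathbf{X})\prod_{i\in S}X_i]$, and the degree-$k$ Fourier weight is $\mathbf{W}_{k}[f]:=\sum_{|S|=k}\hat{f}_{S}^{2}$. A sequence $\{f_{n}:\{-1,1\}^{n}\to\mathbb{R}\}$ is Fourier-weight stable if $\lim_{n\to\infty}\sum_{k=n-k_{0}}^{n}\mathbf{W}_{k}[f_{n}]=0$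 for every fixed $k_{0}\ge0$. $o_n(1)$ denotes a term vanishing as $n\to\infty$. *)

theory Defs
  imports "HOL-Probability.Probability" "HOL-Probability.Product_PMF"
begin

text \<open>
  Points of the discrete cube of dimension \<open>n\<close> are extensional functions on \<open>{..<n}\<close> with
  values in \<open>{-1, 1}\<close>, so that the dimension may vary along a sequence.
\<close>

definition cube :: "nat \<Rightarrow> (nat \<Rightarrow> real) set" where
  "cube n = {..<n} \<rightarrow>\<^sub>E {-1, 1}"

definition ones :: "nat \<Rightarrow> nat \<Rightarrow> real" where
  "ones n = (\<lambda>i\<in>{..<n}. 1)"

definition cmult :: "nat \<Rightarrow> (nat \<Rightarrow> real) \<Rightarrow> (nat \<Rightarrow> real) \<Rightarrow> nat \<Rightarrow> real" where
  "cmult n x z = (\<lambda>i\<in>{..<n}. x i * z i)"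

definition hdist :: "nat \<Rightarrow> (nat \<Rightarrow> real) \<Rightarrow> (nat \<Rightarrow> real) \<Rightarrow> nat" where
  "hdist n x y = card {i \<in> {..<n}. x i \<noteq> y i}"

definition hsphere :: "nat \<Rightarrow> (nat \<Rightarrow> real) \<Rightarrow> nat \<Rightarrow> (nat \<Rightarrow> real) set" where
  "hsphere n c r = {x \<in> cube n. hdist n x c = r}"

definition hball :: "nat \<Rightarrow> (nat \<Rightarrow> real) \<Rightarrow> nat \<Rightarrow> (nat \<Rightarrow> real) set" where
  "hball n c r = {x \<in> cube n. hdist n x c \<le> r}"

definition subcube :: "nat \<Rightarrow> nat set \<Rightarrow> (nat \<Rightarrow> real) \<Rightarrow> (nat \<Rightarrow> real) set" where
  "subcube n T a = {x \<in> cube n. \<forall>i\<in>T. x i = a i}"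

abbreviation cube_pmf :: "nat \<Rightarrow> (nat \<Rightarrow> real) pmf" where
  "cube_pmf n \<equiv> pmf_of_set (cube n)"

text \<open>
  Expectation of \<open>f(X) f(X \<circ> Z)\<close> for \<open>X\<close> uniform on the cube and \<open>Z\<close> independent of \<open>X\<close>
  with law \<open>Q\<close>.
\<close>

definition noise_stab ::
    "nat \<Rightarrow> (nat \<Rightarrow> real) pmf \<Rightarrow> ((nat \<Rightarrow> real) \<Rightarrow> real) \<Rightarrow> real" where
  "noise_stab n Q f =
     measure_pmf.expectation (pair_pmf (cube_pmf n) Q) (\<lambda>(x, z). f x * f (cmult n x z))"

definition SStab :: "nat \<Rightarrow> nat \<Rightarrow> ((nat \<Rightarrow> real) \<Rightarrow> real) \<Rightarrow> real" where
  "SStab n r f = noise_stab n (pmf_of_set (hsphere n (ones n) r)) f"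

definition BStab :: "nat \<Rightarrow> nat \<Rightarrow> ((nat \<Rightarrow> real) \<Rightarrow> real) \<Rightarrow> real" where
  "BStab n r f = noise_stab n (pmf_of_set (hball n (ones n) r)) f"

definition iid_noise_pmf :: "nat \<Rightarrow> real \<Rightarrow> (nat \<Rightarrow> real) pmf" where
  "iid_noise_pmf n \<beta> =
     Pi_pmf {..<n} undefined (\<lambda>_. map_pmf (\<lambda>b. if b then -1 else 1) (bernoulli_pmf \<beta>))"

definition Stab :: "nat \<Rightarrow> real \<Rightarrow> ((nat \<Rightarrow> real) \<Rightarrow> real) \<Rightarrow> real" where
  "Stab n \<beta> f = noise_stab n (iid_noise_pmf n \<beta>) f"

definition fourier_coeff :: "nat \<Rightarrow> ((nat \<Rightarrow> real) \<Rightarrow> real) \<Rightarrow> nat set \<Rightarrow> real" where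
  "fourier_coeff n f S = measure_pmf.expectation (cube_pmf n) (\<lambda>x. f x * (\<Prod>i\<in>S. x i))"

definition fourier_weight :: "nat \<Rightarrow> nat \<Rightarrow> ((nat \<Rightarrow> real) \<Rightarrow> real) \<Rightarrow> real" where
  "fourier_weight n k f = (\<Sum>S | S \<subseteq> {..<n} \<and> card S = k. (fourier_coeff n f S)\<^sup>2)"

text \<open>
  The truncated subtraction \<open>n - k\<^sub>0\<close> only affects the finitely many \<open>n < k\<^sub>0\<close>.
\<close>

definition fourier_weight_stable :: "(nat \<Rightarrow> (nat \<Rightarrow> real) \<Rightarrow> real) \<Rightarrow> bool" where
  "fourier_weight_stable f \<longleftrightarrow>
     (\<forall>k\<^sub>0. (\<lambda>n. \<Sum>k = n - k\<^sub>0..n. fourier_weight n k (f n)) \<longlonglongrightarrow> 0)"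

text \<open>
  \<open>P n r \<epsilon>\<close> is a relation containing an error term \<open>\<epsilon> = o\<^sub>n(1)\<close>, which may depend on \<open>\<delta>\<close> but is
  uniform over all \<open>r\<close> with \<open>r / n \<in> [\<delta>, 1/2 - \<delta>]\<close>.  For \<open>n = 0\<close> and \<open>\<delta> > 0\<close> no \<open>r\<close> qualifies.
\<close>

definition with_o1 :: "real \<Rightarrow> (nat \<Rightarrow> nat \<Rightarrow> real \<Rightarrow> bool) \<Rightarrow> bool" where
  "with_o1 \<delta> P \<longleftrightarrow>
     (\<exists>e :: nat \<Rightarrow> real. e \<longlonglongrightarrow> 0 \<and>
        (\<forall>n r. real r / real n \<in> {\<delta>..1/2 - \<delta>} \<longrightarrow> P n r (e n)))"

end

theory Submission
  imports Defs "HOL-Computational_Algebra.Polynomial" "HOL-Real_Asymp.Real_Asymp"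
begin

text \<open>
  In Fourier terms each stability is \<open>\<Sum>\<^sub>k W\<^sub>k m(k)\<close>, with multiplier \<open>m(k) = \<rho>^k\<close>, \<open>\<rho> = 1 - 2\<beta>\<close>, for
  i.i.d. noise and a normalized Krawtchouk polynomial \<open>\<kappa>(k)\<close> for sphere noise.  Uniformly in \<open>k\<close> and \<open>r\<close>,
  \<open>\<kappa>(k) = \<rho>^k + (-1)^r \<rho>^(n-k) + o(1)\<close>: for bounded \<open>k\<close> this follows from the three-term recurrence,
  in the middle range both sides are small because \<open>(1 - x)^k (1 + x)^(n-k)\<close> contains a high power of
  \<open>1 - x^2\<close>, and the symmetry \<open>\<kappa>(n-k) = (-1)^r \<kappa>(k)\<close> does the rest.  The ball multiplier is a
  multiple of \<open>\<kappa>(k) + \<kappa>(k-1)\<close>, hence \<open>\<rho>^k + (-1)^r \<rho> \<rho>^(n-k) + o(1)\<close>.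

  Everything then depends on \<open>D = \<Sum>\<^sub>k W\<^sub>k \<rho>^(n-k)\<close>, the expectation of \<open>f(X) f(Y)\<close> times the
  parity of the i.i.d. noise.  For nonnegative \<open>f\<close> it lies between \<open>0\<close> and the noise stability; it
  equals the latter if the support of \<open>f\<close> has constant parity, and vanishes asymptotically if \<open>f\<close> is
  Fourier-weight stable.  Subcubes and balls are Fourier-weight stable because their total influence
  is \<open>o(n)\<close>.
\<close>

section \<open>Fourier analysis on the cube\<close>

abbreviation walsh :: "nat set \<Rightarrow> (nat \<Rightarrow> real) \<Rightarrow> real" where
  "walsh S x \<equiv> (\<Prod>i\<in>S. x i)"

text \<open>For fixed noise \<open>z\<close> this is the expectation over \<open>X\<close> alone.
  Every stability is its average under the noise law, and both its sign and its Fourier expansion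
  are easy to control.\<close>

definition autocorr :: "nat \<Rightarrow> ((nat \<Rightarrow> real) \<Rightarrow> real) \<Rightarrow> (nat \<Rightarrow> real) \<Rightarrow> real" where
  "autocorr n f z = (\<Sum>x\<in>cube n. f x * f (cmult n x z)) / 2 ^ n"

lemma finite_cube [simp]: "finite (cube n)"
  unfolding cube_def by (intro finite_PiE) auto

lemma card_cube: "card (cube n) = 2 ^ n"
  unfolding cube_def by (simp add: card_PiE numeral_2_eq_2)

lemma ones_in_cube [simp]: "ones n \<in> cube n"
  by (auto simp: cube_def ones_def)

lemma cube_not_empty [simp]: "cube n \<noteq> {}"
  using ones_in_cube by blast

lemma cube_values: "x \<in> cube n \<Longrightarrow> i < n \<Longrightarrow> x i = -1 \<or> x i = 1"
  by (auto simp: cube_def PiE_iff)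

lemma cube_eqI:
  assumes "x \<in> cube n" "y \<in> cube n" "\<And>i. i < n \<Longrightarrow> x i = y i"
  shows "x = y"
  using assms unfolding cube_def by (intro PiE_ext[of x "{..<n}" _ y]) auto

lemma cmult_in_cube [simp]: "x \<in> cube n \<Longrightarrow> z \<in> cube n \<Longrightarrow> cmult n x z \<in> cube n"
proof -
  assume x: "x \<in> cube n" and z: "z \<in> cube n"
  have "x i * z i \<in> {-1, 1}" if "i < n" for i
    using cube_values[OF x that] cube_values[OF z that] by auto
  then show ?thesis by (simp add: cube_def cmult_def PiE_iff)
qed

lemma cmult_apply [simp]: "i < n \<Longrightarrow> cmult n x z i = x i * z i"
  by (simp add: cmult_def)

lemma ones_apply [simp]: "i < n \<Longrightarrow> ones n i = 1"
  by (simp add: ones_def)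

lemma cmult_ones [simp]: "x \<in> cube n \<Longrightarrow> cmult n x (ones n) = x"
  by (rule cube_eqI) auto

lemma expectation_cube:
  fixes g :: "_ \<Rightarrow> real"
  shows "measure_pmf.expectation (cube_pmf n) g = (\<Sum>x\<in>cube n. g x) / 2 ^ n"
  by (simp add: integral_pmf_of_set card_cube)

text \<open>Distributivity over the product structure; it evaluates the i.i.d. expectation, the
  generating function of the spheres and the size of a subcube.\<close>

lemma sum_cube_prod:
  fixes g :: "nat \<Rightarrow> real \<Rightarrow> 'a::comm_semiring_1"
  shows "(\<Sum>z\<in>cube n. \<Prod>i<n. g i (z i)) = (\<Prod>i<n. g i (-1) + g i 1)"
  unfolding cube_def by (subst prod_sum_PiE [symmetric]) auto

lemma walsh_cmult:
  assumes "S \<subseteq> {..<n}"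
  shows "walsh S (cmult n x z) = walsh S x * walsh S z"
proof -
  have "walsh S (cmult n x z) = (\<Prod>i\<in>S. x i * z i)"
    using assms by (intro prod.cong) auto
  then show ?thesis by (simp add: prod.distrib)
qed

lemma walsh_ones: "S \<subseteq> {..<n} \<Longrightarrow> walsh S (ones n) = 1"
  by (intro prod.neutral) auto

text \<open>Orthogonality of characters: the sum factors as \<open>\<Prod>i<n. x i + 1\<close>, and
  a single coordinate equal to -1 kills it.\<close>

lemma sum_walsh:
  assumes "x \<in> cube n"
  shows "(\<Sum>S\<in>Pow {..<n}. walsh S x) = (if x = ones n then 2 ^ n else 0)"
proof -
  have "(\<Sum>S\<in>Pow {..<n}. walsh S x) = (\<Prod>i<n. x i + 1)"
    by (simp add: prod_add)
  also have "\<dots> = (if x = ones n then 2 ^ n else 0)"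
  proof (cases "x = ones n")
    case False
    then obtain i where "i < n" "x i \<noteq> 1"
      using cube_eqI[OF assms ones_in_cube[of n]] by auto
    then have "\<exists>i\<in>{..<n}. x i + 1 = 0"
      using cube_values[OF assms, of i] by (intro bexI[of _ i]) auto
    then show ?thesis using False by (auto simp: prod_zero_iff)
  qed simp
  finally show ?thesis .
qed

text \<open>Signs are their own inverses. In the expansion below this collapses a double sum over
  \<open>x\<close> and \<open>y\<close> to \<open>y = cmult n x z\<close>.\<close>

lemma cmult_eq_ones_iff:
  assumes "x \<in> cube n" "y \<in> cube n" "z \<in> cube n"
  shows "cmult n (cmult n x y) z = ones n \<longleftrightarrow> y = cmult n x z"
proof
  assume eq: "cmult n (cmult n x y) z = ones n"
  show "y = cmult n x z"
  proof (rule cube_eqI[of _ n])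
    fix i assume i: "i < n"
    have "x i * y i * z i = 1"
      using fun_cong[OF eq, of i] i by simp
    then show "y i = cmult n x z i"
      using cube_values[OF assms(1) i] cube_values[OF assms(2) i] cube_values[OF assms(3) i] i by auto
  qed (use assms in auto)
next
  assume eq: "y = cmult n x z"
  show "cmult n (cmult n x y) z = ones n"
  proof (rule cube_eqI[of _ n])
    fix i assume i: "i < n"
    show "cmult n (cmult n x y) z i = ones n i"
      using cube_values[OF assms(1) i] cube_values[OF assms(3) i] i eq by auto
  qed (use assms in auto)
qed

text \<open>Squaring a coefficient gives a double sum over \<open>x\<close> and \<open>y\<close>,
  and the three characters merge into one at the product of \<open>x\<close>, \<open>y\<close>,
  \<open>z\<close>. Summing over \<open>S\<close> leaves only \<open>y = cmult n x z\<close>, by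
  orthogonality.\<close>

lemma autocorr_fourier:
  assumes z: "z \<in> cube n"
  shows "autocorr n f z = (\<Sum>S\<in>Pow {..<n}. (fourier_coeff n f S)\<^sup>2 * walsh S z)"
proof -
  have sq: "(fourier_coeff n f S)\<^sup>2 * walsh S z =
      (\<Sum>x\<in>cube n. \<Sum>y\<in>cube n. f x * f y * walsh S (cmult n (cmult n x y) z)) / 4 ^ n"
    if "S \<subseteq> {..<n}" for S
  proof -
    have p4: "(2::real) ^ n * 2 ^ n = 4 ^ n" by (simp flip: power_mult_distrib)
    have "(fourier_coeff n f S)\<^sup>2 * walsh S z =
        (\<Sum>x\<in>cube n. f x * walsh S x) * (\<Sum>x\<in>cube n. f x * walsh S x) * walsh S z / 4 ^ n"
      by (simp add: fourier_coeff_def expectation_cube power2_eq_square p4)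
    also have "(\<Sum>x\<in>cube n. f x * walsh S x) * (\<Sum>x\<in>cube n. f x * walsh S x) * walsh S z =
        (\<Sum>x\<in>cube n. \<Sum>y\<in>cube n. f x * walsh S x * (f y * walsh S y) * walsh S z)"
      by (subst sum_product) (simp only: sum_distrib_right)
    also have "\<dots> = (\<Sum>x\<in>cube n. \<Sum>y\<in>cube n. f x * f y * walsh S (cmult n (cmult n x y) z))"
      by (simp only: walsh_cmult[OF that] mult_ac)
    finally show ?thesis .
  qed
  have "(\<Sum>S\<in>Pow {..<n}. (fourier_coeff n f S)\<^sup>2 * walsh S z) =
      (\<Sum>S\<in>Pow {..<n}. \<Sum>x\<in>cube n. \<Sum>y\<in>cube n.
         f x * f y * walsh S (cmult n (cmult n x y) z)) / 4 ^ n"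
    by (simp add: sq sum_divide_distrib)
  also have "(\<Sum>S\<in>Pow {..<n}. \<Sum>x\<in>cube n. \<Sum>y\<in>cube n.
         f x * f y * walsh S (cmult n (cmult n x y) z)) =
      (\<Sum>x\<in>cube n. \<Sum>y\<in>cube n. f x * f y *
        (\<Sum>S\<in>Pow {..<n}. walsh S (cmult n (cmult n x y) z)))"
    by (subst sum.swap, intro sum.cong refl, subst sum.swap) (simp add: sum_distrib_left)
  also have "\<dots> = (\<Sum>x\<in>cube n. \<Sum>y\<in>cube n.
      if y = cmult n x z then 2 ^ n * (f x * f y) else 0)"
    using z by (intro sum.cong refl) (simp add: sum_walsh cmult_eq_ones_iff)
  also have "\<dots> = 2 ^ n * (\<Sum>x\<in>cube n. f x * f (cmult n x z))"
    using z by (simp add: sum.delta sum_distrib_left)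
  also have "\<dots> / 4 ^ n = autocorr n f z"
  proof -
    have "(4::real) ^ n = 2 ^ n * 2 ^ n" by (simp flip: power_mult_distrib)
    then show ?thesis by (simp add: autocorr_def)
  qed
  finally show ?thesis by simp
qed

lemma autocorr_ones:
  "autocorr n f (ones n) = measure_pmf.expectation (cube_pmf n) (\<lambda>x. (f x)\<^sup>2)"
  by (simp add: autocorr_def expectation_cube power2_eq_square)

lemma parseval:
  "(\<Sum>S\<in>Pow {..<n}. (fourier_coeff n f S)\<^sup>2) =
     measure_pmf.expectation (cube_pmf n) (\<lambda>x. (f x)\<^sup>2)"
proof -
  have "autocorr n f (ones n) = (\<Sum>S\<in>Pow {..<n}. (fourier_coeff n f S)\<^sup>2 * walsh S (ones n))"
    by (rule autocorr_fourier) simp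
  also have "\<dots> = (\<Sum>S\<in>Pow {..<n}. (fourier_coeff n f S)\<^sup>2)"
    by (intro sum.cong refl) (simp add: walsh_ones)
  finally show ?thesis by (simp add: autocorr_ones)
qed

lemma autocorr_nonneg:
  assumes "\<And>x. x \<in> cube n \<Longrightarrow> 0 \<le> f x" "z \<in> cube n"
  shows "0 \<le> autocorr n f z"
  unfolding autocorr_def by (intro divide_nonneg_nonneg sum_nonneg mult_nonneg_nonneg assms)
    (use assms in auto)

lemma expectation_pmf_cube:
  assumes "set_pmf Q \<subseteq> cube n"
  shows "measure_pmf.expectation Q g = (\<Sum>z\<in>cube n. g z * pmf Q z)"
  using assms by (intro integral_measure_pmf_real) auto

lemma noise_stab_autocorr:
  assumes "set_pmf Q \<subseteq> cube n"
  shows "noise_stab n Q f = measure_pmf.expectation Q (autocorr n f)"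
proof -
  have "noise_stab n Q f = (\<Sum>(x, z)\<in>cube n \<times> cube n.
      f x * f (cmult n x z) * pmf (pair_pmf (cube_pmf n) Q) (x, z))"
    unfolding noise_stab_def using assms
    by (subst integral_measure_pmf_real[of "cube n \<times> cube n"]) (auto intro!: sum.cong)
  also have "\<dots> = (\<Sum>(x, z)\<in>cube n \<times> cube n. f x * f (cmult n x z) * pmf Q z / 2 ^ n)"
    by (intro sum.cong) (auto simp: pmf_pair card_cube)
  also have "\<dots> = (\<Sum>z\<in>cube n. \<Sum>x\<in>cube n. f x * f (cmult n x z) * pmf Q z / 2 ^ n)"
    by (subst sum.swap) (simp only: sum.cartesian_product)
  also have "\<dots> = (\<Sum>z\<in>cube n. autocorr n f z * pmf Q z)"
    by (intro sum.cong refl) (simp add: autocorr_def sum_divide_distrib sum_distrib_right)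
  finally show ?thesis by (simp add: expectation_pmf_cube[OF assms])
qed

text \<open>Noise acts diagonally on characters, so a noise law enters only through its character
  expectations. For the three laws at hand these depend on \<open>card S\<close> alone.\<close>

lemma noise_stab_fourier:
  assumes "set_pmf Q \<subseteq> cube n"
  shows "noise_stab n Q f =
    (\<Sum>S\<in>Pow {..<n}. (fourier_coeff n f S)\<^sup>2 * measure_pmf.expectation Q (walsh S))"
proof -
  have "noise_stab n Q f =
      (\<Sum>z\<in>cube n. \<Sum>S\<in>Pow {..<n}. (fourier_coeff n f S)\<^sup>2 * walsh S z * pmf Q z)"
    by (simp add: noise_stab_autocorr[OF assms] expectation_pmf_cube[OF assms]
          autocorr_fourier sum_distrib_right)
  also have "\<dots> = (\<Sum>S\<in>Pow {..<n}. (fourier_coeff n f S)\<^sup>2 * (\<Sum>z\<in>cube n. walsh S z * pmf Q z))"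
    by (subst sum.swap) (simp add: sum_distrib_left mult.assoc)
  finally show ?thesis by (simp add: expectation_pmf_cube[OF assms])
qed

section \<open>The three noise laws\<close>

lemma set_iid_noise_pmf: "set_pmf (iid_noise_pmf n \<beta>) \<subseteq> cube n"
proof
  fix z assume z: "z \<in> set_pmf (iid_noise_pmf n \<beta>)"
  \<comment> \<open>The default \<open>undefined\<close> of the product law is the value that
    extensionality prescribes outside \<open>{..<n}\<close>, so samples are points of the
    cube.\<close>
  then have "z \<in> PiE_dflt {..<n} undefined
      (set_pmf \<circ> (\<lambda>_. map_pmf (\<lambda>b. if b then -1 else 1 :: real) (bernoulli_pmf \<beta>)))"
    unfolding iid_noise_pmf_def by (rule subsetD[OF set_Pi_pmf_subset', rotated]) simp
  then show "z \<in> cube n"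
    by (fastforce simp: PiE_dflt_def cube_def PiE_iff extensional_def split: if_splits)
qed

text \<open>Coordinates are independent, and each one in \<open>S\<close> contributes its mean
  \<open>(1 - \<beta>) - \<beta>\<close>.\<close>

lemma expectation_iid_walsh:
  assumes \<beta>: "0 \<le> \<beta>" "\<beta> \<le> 1" and S: "S \<subseteq> {..<n}"
  shows "measure_pmf.expectation (iid_noise_pmf n \<beta>) (walsh S) = (1 - 2 * \<beta>) ^ card S"
proof -
  let ?p = "map_pmf (\<lambda>b. if b then -1 else 1 :: real) (bernoulli_pmf \<beta>)"
  have pm: "pmf ?p (-1) = \<beta>" and pp: "pmf ?p 1 = 1 - \<beta>"
  proof -
    have "(\<lambda>b. if b then -1 else 1 :: real) -` {-1} = {True}"
         "(\<lambda>b. if b then -1 else 1 :: real) -` {1} = {False}"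
      by (auto split: if_splits)
    then show "pmf ?p (-1) = \<beta>" "pmf ?p 1 = 1 - \<beta>"
      using \<beta> by (simp_all add: pmf_map measure_pmf_single)
  qed
  have "measure_pmf.expectation (iid_noise_pmf n \<beta>) (walsh S) =
      (\<Sum>z\<in>cube n. \<Prod>i<n. (if i \<in> S then z i else 1) * pmf ?p (z i))"
    unfolding expectation_pmf_cube[OF set_iid_noise_pmf]
  proof (intro sum.cong refl)
    fix z assume z: "z \<in> cube n"
    have "pmf (iid_noise_pmf n \<beta>) z = (\<Prod>i<n. pmf ?p (z i))"
      unfolding iid_noise_pmf_def using z
      by (subst pmf_Pi') (auto simp: cube_def PiE_iff extensional_def)
    moreover have "walsh S z = (\<Prod>i<n. if i \<in> S then z i else 1)"
      using S by (simp add: prod.inter_restrict[symmetric] Int_absorb1)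
    ultimately show "walsh S z * pmf (iid_noise_pmf n \<beta>) z =
        (\<Prod>i<n. (if i \<in> S then z i else 1) * pmf ?p (z i))"
      by (simp add: prod.distrib)
  qed
  also have "\<dots> = (\<Prod>i<n. if i \<in> S then 1 - 2 * \<beta> else 1)"
    by (subst sum_cube_prod) (auto intro!: prod.cong simp: pm pp)
  also have "\<dots> = (1 - 2 * \<beta>) ^ card S"
    using S by (simp add: prod.inter_restrict[symmetric] Int_absorb1)
  finally show ?thesis .
qed

text \<open>\<open>kraw n k r\<close> is the value at \<open>k\<close> of the Krawtchouk polynomial of degree \<open>r\<close>, read off from
  its generating function.\<close>

definition kraw :: "nat \<Rightarrow> nat \<Rightarrow> nat \<Rightarrow> real" where
  "kraw n k r = coeff ([:1, -1:] ^ k * [:1, 1:] ^ (n - k)) r"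

section \<open>Character sums over spheres and balls\<close>

lemma prod_monom: "finite A \<Longrightarrow>
    (\<Prod>i\<in>A. monom (a i) (b i)) = monom (\<Prod>i\<in>A. a i) (\<Sum>i\<in>A. b i)"
  for a :: "'i \<Rightarrow> 'a::comm_semiring_1"
  by (induction A rule: finite_induct) (simp_all add: mult_monom)

lemma hdist_ones: "z \<in> cube n \<Longrightarrow> hdist n z (ones n) = (\<Sum>i<n. if z i = -1 then 1 else 0)"
proof -
  assume z: "z \<in> cube n"
  have "{i \<in> {..<n}. z i \<noteq> ones n i} = {i \<in> {..<n}. z i = -1}"
    using cube_values[OF z] by fastforce
  then show ?thesis by (simp add: hdist_def flip: sum.inter_filter)
qed

text \<open>Recording the distance as an exponent makes the sum factor over coordinates: the values
  1 and -1 contribute \<open>1\<close> and \<open>x\<close> outside \<open>S\<close>, but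
  \<open>1\<close> and \<open>-x\<close> inside.\<close>

lemma sum_cube_monom_walsh:
  assumes S: "S \<subseteq> {..<n}"
  shows "(\<Sum>z\<in>cube n. monom (walsh S z) (hdist n z (ones n))) =
    [:1, -1:] ^ card S * [:1, 1:] ^ (n - card S)"
proof -
  have "(\<Sum>z\<in>cube n. monom (walsh S z) (hdist n z (ones n))) =
      (\<Sum>z\<in>cube n. \<Prod>i<n. monom (if i \<in> S then z i else 1) (if z i = -1 then 1 else 0))"
    using S by (intro sum.cong refl)
      (simp add: prod_monom hdist_ones prod.inter_restrict[symmetric] Int_absorb1)
  also have "\<dots> = (\<Prod>i<n. if i \<in> S then [:1, -1:] else [:1, 1:])"
    by (subst sum_cube_prod) (auto intro!: prod.cong simp: monom_altdef)
  also have "\<dots> = [:1, -1:] ^ card S * [:1, 1:] ^ (n - card S)"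
    using S by (subst prod.If_cases) (auto simp: Int_absorb1 Diff_eq[symmetric] card_Diff_subset
        finite_subset[OF S])
  finally show ?thesis .
qed

lemma sum_sphere_walsh:
  assumes S: "S \<subseteq> {..<n}"
  shows "(\<Sum>z\<in>hsphere n (ones n) r. walsh S z) = kraw n (card S) r"
proof -
  have "kraw n (card S) r = coeff (\<Sum>z\<in>cube n. monom (walsh S z) (hdist n z (ones n))) r"
    by (simp add: kraw_def sum_cube_monom_walsh[OF S])
  also have "\<dots> = (\<Sum>z\<in>cube n. if hdist n z (ones n) = r then walsh S z else 0)"
    by (simp add: coeff_sum)
  also have "\<dots> = (\<Sum>z\<in>hsphere n (ones n) r. walsh S z)"
    unfolding hsphere_def by (rule sum.inter_filter[symmetric]) simp
  finally show ?thesis by simp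
qed

lemma kraw_0: "kraw n 0 r = real (n choose r)"
proof (cases "r \<le> n")
  case True
  then show ?thesis by (simp add: kraw_def coeff_linear_poly_power)
next
  case False
  then have "coeff ([:1, 1:] ^ n) r = (0::real)"
    by (intro coeff_eq_0) (use degree_linear_power[of "1::real" n] in simp)
  then show ?thesis using False by (simp add: kraw_def)
qed

lemma card_hsphere_ones: "card (hsphere n (ones n) r) = n choose r"
  using sum_sphere_walsh[of "{}" n r] kraw_0[of n r] by simp

lemma finite_hsphere [simp]: "finite (hsphere n c r)"
  by (simp add: hsphere_def)

lemma hsphere_subset_cube: "hsphere n c r \<subseteq> cube n"
  by (auto simp: hsphere_def)

lemma finite_hball [simp]: "finite (hball n c r)"
  by (simp add: hball_def)

lemma hball_subset_cube: "hball n c r \<subseteq> cube n"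
  by (auto simp: hball_def)

lemma hsphere_ones_not_empty: "r \<le> n \<Longrightarrow> hsphere n (ones n) r \<noteq> {}"
  using card_hsphere_ones[of n r] by force

lemma hball_ones_not_empty: "hball n (ones n) r \<noteq> {}"
proof -
  have "ones n \<in> hball n (ones n) r" by (simp add: hball_def hdist_def)
  then show ?thesis by blast
qed

lemma sum_hball: "(\<Sum>z\<in>hball n c r. g z) = (\<Sum>j\<le>r. \<Sum>z\<in>hsphere n c j. g z)"
proof -
  have "hball n c r = (\<Union>j\<le>r. hsphere n c j)"
    by (auto simp: hball_def hsphere_def)
  then show ?thesis
    by (simp, subst sum.UNION_disjoint) (auto simp: hsphere_def)
qed

lemma card_hball_ones: "card (hball n (ones n) r) = (\<Sum>j\<le>r. n choose j)"
  using sum_hball[of "\<lambda>_. 1::nat" n "ones n" r] by (simp add: card_hsphere_ones)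

lemma expectation_sphere_walsh:
  assumes "S \<subseteq> {..<n}" "r \<le> n"
  shows "measure_pmf.expectation (pmf_of_set (hsphere n (ones n) r)) (walsh S) =
    kraw n (card S) r / real (n choose r)"
  using assms
  by (simp add: integral_pmf_of_set hsphere_ones_not_empty card_hsphere_ones sum_sphere_walsh)

text \<open>Multiplication by \<open>1 - x\<close> replaces coefficients by consecutive differences,
  which telescope.\<close>

lemma sum_coeff_linear_mult: "(\<Sum>j\<le>r. coeff ([:1, -1:] * p) j) = coeff p r"
  for p :: "real poly"
  by (induction r) (auto simp: coeff_pCons)

text \<open>With \<open>P = (1 - x)^(k-1) (1 + x)^(n-k)\<close>, the left-hand side is the coefficient of \<open>x^r\<close> in
  \<open>P\<close>, and \<open>2 P\<close> is the sum of \<open>(1 - x) P\<close> and \<open>(1 + x) P\<close>.\<close>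

lemma sum_kraw:
  assumes "Suc k \<le> n"
  shows "(\<Sum>j\<le>r. kraw n (Suc k) j) = (kraw n (Suc k) r + kraw n k r) / 2"
proof -
  define P :: "real poly" where "P = [:1, -1:] ^ k * [:1, 1:] ^ (n - Suc k)"
  have n: "n - k = Suc (n - Suc k)" using assms by simp
  have 1: "[:1, -1:] ^ Suc k * [:1, 1:] ^ (n - Suc k) = [:1, -1:] * P"
    by (simp only: P_def power_Suc mult.assoc)
  have 2: "[:1, -1:] ^ k * [:1, 1:] ^ (n - k) = [:1, 1:] * P"
    by (simp only: P_def n power_Suc mult_ac)
  have "coeff ([:1, -1:] * P) r + coeff ([:1, 1:] * P) r = 2 * coeff P r"
    by (simp add: coeff_pCons split: nat.split)
  then have "kraw n (Suc k) r + kraw n k r = 2 * coeff P r"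
    unfolding kraw_def 1 2 .
  moreover have "(\<Sum>j\<le>r. kraw n (Suc k) j) = coeff P r"
    unfolding kraw_def 1 by (rule sum_coeff_linear_mult)
  ultimately show ?thesis by simp
qed

text \<open>The ball is a union of spheres, and \<open>sum_kraw\<close> collapses the sum over
  radii. The empty set is special: its expectation is 1 and there is no degree below it.\<close>

lemma expectation_ball_walsh:
  assumes "S \<subseteq> {..<n}" "S \<noteq> {}"
  shows "measure_pmf.expectation (pmf_of_set (hball n (ones n) r)) (walsh S) =
    (kraw n (card S) r + kraw n (card S - 1) r) / (2 * (\<Sum>j\<le>r. real (n choose j)))"
proof -
  obtain k where k: "card S = Suc k"
    using assms by (metis card_0_eq finite_lessThan finite_subset not0_implies_Suc)
  have "card S \<le> n"
    using card_mono[OF _ assms(1)] by simp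
  then have "(\<Sum>j\<le>r. kraw n (card S) j) = (kraw n (card S) r + kraw n (card S - 1) r) / 2"
    using k sum_kraw[of k n r] by simp
  then show ?thesis
    using assms
    by (simp only: integral_pmf_of_set hball_ones_not_empty card_hball_ones sum_hball
          sum_sphere_walsh finite_hball not_False_eq_True of_nat_sum divide_divide_eq_left)
qed

section \<open>Krawtchouk polynomials\<close>

text \<open>Substituting \<open>-x\<close> swaps the factors \<open>1 - x\<close> and
  \<open>1 + x\<close> and multiplies the coefficient of \<open>x^r\<close> by
  \<open>(-1)^r\<close>.\<close>

lemma kraw_symmetric:
  assumes "k \<le> n"
  shows "kraw n (n - k) r = (-1) ^ r * kraw n k r"
proof -
  have "pcompose ([:1, -1:] ^ k * [:1, 1:] ^ (n - k)) [:0, -1:] =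
      [:1, 1:] ^ k * [:1, -1 :: real:] ^ (n - k)"
    by (rule poly_eq_poly_eq_iff[THEN iffD1], rule ext) (simp add: poly_pcompose)
  then have "[:1, -1:] ^ (n - k) * [:1, 1:] ^ k =
      pcompose ([:1, -1 :: real:] ^ k * [:1, 1:] ^ (n - k)) [:0, -1:]"
    by (simp add: mult.commute)
  then show ?thesis
    using assms unfolding kraw_def by (simp add: coeff_pcompose_linear)
qed

lemma coeff_x_pderiv: "coeff (pCons 0 (pderiv p)) r = real r * coeff p r"
  for p :: "real poly"
  by (cases r) (simp_all add: coeff_pderiv)

text \<open>For \<open>G = (1 - x)^(j+1) (1 + x)^(m+1)\<close>, both sides are the coefficient of \<open>x^r\<close> in
  \<open>(j + m + 2) G - 2 x G'\<close>.\<close>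

lemma kraw_recurrence:
  "real (Suc m) * kraw (j + m + 2) (j + 2) r + real (Suc j) * kraw (j + m + 2) j r =
     (real (j + m + 2) - 2 * real r) * kraw (j + m + 2) (Suc j) r"
proof -
  define G :: "real poly" where "G = [:1, -1:] ^ Suc j * [:1, 1:] ^ Suc m"
  define a :: "real poly" where "a = [:1, -1:] ^ (j + 2) * [:1, 1:] ^ m"
  define b :: "real poly" where "b = [:1, -1:] ^ j * [:1, 1:] ^ (m + 2)"
  have "smult (real (Suc m)) a + smult (real (Suc j)) b =
      smult (real (j + m + 2)) G - smult 2 (pCons 0 (pderiv G))"
    unfolding G_def a_def b_def
    by (rule poly_eq_poly_eq_iff[THEN iffD1], rule ext)
       (simp add: pderiv_mult pderiv_power_Suc pderiv_pCons algebra_simps del: power_Suc,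
        simp add: algebra_simps)
  then have "real (Suc m) * coeff a r + real (Suc j) * coeff b r =
      (real (j + m + 2) - 2 * real r) * coeff G r"
    by (metis (no_types, opaque_lifting) coeff_add coeff_diff coeff_smult coeff_x_pderiv
        left_diff_distrib mult.assoc)
  moreover have "kraw (j + m + 2) (j + 2) r = coeff a r" "kraw (j + m + 2) j r = coeff b r"
      "kraw (j + m + 2) (Suc j) r = coeff G r"
    by (simp_all add: kraw_def a_def b_def G_def Suc_diff_le del: power_Suc)
  ultimately show ?thesis by simp
qed

text \<open>Start of the recurrence: with \<open>n = Suc m\<close>, the operator
  \<open>n - 2 x d/dx\<close> turns \<open>(1 + x)^n\<close> into
  \<open>n (1 - x) (1 + x)^m\<close>.\<close>

lemma kraw_1:
  "real (Suc m) * kraw (Suc m) 1 r = (real (Suc m) - 2 * real r) * kraw (Suc m) 0 r"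
proof -
  define G :: "real poly" where "G = [:1, 1:] ^ Suc m"
  define a :: "real poly" where "a = [:1, -1:] * [:1, 1:] ^ m"
  have "smult (real (Suc m)) a = smult (real (Suc m)) G - smult 2 (pCons 0 (pderiv G))"
    unfolding G_def a_def
    by (rule poly_eq_poly_eq_iff[THEN iffD1], rule ext)
       (simp add: pderiv_power_Suc pderiv_pCons algebra_simps del: power_Suc,
        simp add: algebra_simps)
  then have "real (Suc m) * coeff a r = (real (Suc m) - 2 * real r) * coeff G r"
    by (metis (no_types, opaque_lifting) coeff_diff coeff_smult coeff_x_pderiv
        left_diff_distrib mult.assoc)
  then show ?thesis by (simp add: kraw_def a_def G_def)
qed

section \<open>Coefficientwise domination and the middle range of degrees\<close>

definition dominated :: "real poly \<Rightarrow> real poly \<Rightarrow> bool" where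
  "dominated p q \<longleftrightarrow> (\<forall>i. \<bar>coeff p i\<bar> \<le> coeff q i)"

lemma dominated_mult:
  assumes "dominated p q" "dominated p' q'"
  shows "dominated (p * p') (q * q')"
  unfolding dominated_def
proof
  fix i
  have "\<bar>coeff (p * p') i\<bar> \<le> (\<Sum>j\<le>i. \<bar>coeff p j * coeff p' (i - j)\<bar>)"
    unfolding coeff_mult by (rule sum_abs)
  also have "\<dots> \<le> (\<Sum>j\<le>i. coeff q j * coeff q' (i - j))"
    using assms by (intro sum_mono) (auto simp: abs_mult dominated_def intro!: mult_mono
        intro: order_trans[OF abs_ge_zero])
  finally show "\<bar>coeff (p * p') i\<bar> \<le> coeff (q * q') i"
    unfolding coeff_mult .
qed

lemma dominated_power:
  assumes "dominated p q"
  shows "dominated (p ^ k) (q ^ k)"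
proof (induction k)
  case 0
  then show ?case by (simp add: dominated_def coeff_1)
next
  case (Suc k)
  then show ?case using dominated_mult[OF assms Suc] by simp
qed

text \<open>\<open>k\<^sub>0\<close> factors \<open>(1 - x) (1 + x) = 1 - x^2\<close> are split off; in the remaining ones only the sign is
  lost.\<close>

lemma abs_kraw_le_coeff:
  assumes "k\<^sub>0 \<le> k" "k + k\<^sub>0 \<le> n"
  shows "\<bar>kraw n k r\<bar> \<le> coeff ([:1, 0, 1:] ^ k\<^sub>0 * [:1, 1:] ^ (n - 2 * k\<^sub>0)) r"
proof -
  obtain i where i: "k = k\<^sub>0 + i" using assms le_Suc_ex by blast
  obtain l where l: "n = k + k\<^sub>0 + l" using assms le_Suc_ex by blast
  have ab: "[:1, 0, -1:] = [:1, -1:] * [:1, 1 :: real:]" by simp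
  have "[:1, -1:] ^ k * [:1, 1:] ^ (n - k) =
      [:1, 0, -1:] ^ k\<^sub>0 * ([:1, -1:] ^ i * [:1, 1 :: real:] ^ l)"
    unfolding ab i l power_mult_distrib by (simp add: power_add mult_ac)
  moreover have "dominated \<dots> ([:1, 0, 1:] ^ k\<^sub>0 * ([:1, 1:] ^ i * [:1, 1:] ^ l))"
    by (intro dominated_mult dominated_power)
       (auto simp: dominated_def coeff_pCons split: nat.split)
  moreover have "[:1, 1:] ^ i * [:1, 1:] ^ l = [:1, 1 :: real:] ^ (n - 2 * k\<^sub>0)"
    by (simp add: i l flip: power_add)
  ultimately show ?thesis
    by (simp add: dominated_def kraw_def)
qed

lemma abs_kraw_le_binomial:
  assumes "k \<le> n"
  shows "\<bar>kraw n k r\<bar> \<le> real (n choose r)"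
  using abs_kraw_le_coeff[of 0 k n r] assms kraw_0[of n r] by (simp add: kraw_def)

text \<open>Lowering the top index twice produces exactly \<open>(n + 2 - r) (n + 1 - r)\<close>;
  enlarging the second factor gives a square. This treats the term \<open>1\<close> of a factor
  \<open>1 + x^2\<close>, the next lemma the term \<open>x^2\<close>.\<close>

lemma binomial_drop_two_0:
  "real (n choose r) * (real (n + 2) * real (n + 1)) \<le> real ((n + 2) choose r) * (real (n + 2) - real r)\<^sup>2"
proof (cases "r \<le> n")
  case True
  have 1: "(n + 2 - r) * ((n + 2) choose r) = (n + 2) * ((n + 1) choose r)"
    using binomial_absorb_comp[of "n + 2" r] by simp
  have 2: "(n + 1 - r) * ((n + 1) choose r) = (n + 1) * (n choose r)"
    using binomial_absorb_comp[of "n + 1" r] by simp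
  have le: "r \<le> n + 2" "r \<le> n + 1" using True by auto
  have 1: "(real (n + 2) - real r) * real ((n + 2) choose r) = real (n + 2) * real ((n + 1) choose r)"
    by (simp only: 1 flip: of_nat_mult of_nat_diff[OF le(1)])
  have 2: "(real (n + 1) - real r) * real ((n + 1) choose r) = real (n + 1) * real (n choose r)"
    by (simp only: 2 flip: of_nat_mult of_nat_diff[OF le(2)])
  have "real (n choose r) * (real (n + 2) * real (n + 1)) =
      real (n + 2) * ((real (n + 1) - real r) * real ((n + 1) choose r))"
    unfolding 2 by (simp add: algebra_simps)
  also have "\<dots> = (real (n + 1) - real r) * (real (n + 2) * real ((n + 1) choose r))"
    by (simp add: algebra_simps)
  also have "\<dots> = (real (n + 1) - real r) * ((real (n + 2) - real r) * real ((n + 2) choose r))"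
    by (simp only: 1)
  also have "\<dots> \<le> (real (n + 2) - real r) * ((real (n + 2) - real r) * real ((n + 2) choose r))"
    using True by (intro mult_right_mono) auto
  finally show ?thesis by (simp add: power2_eq_square algebra_simps)
qed (simp add: binomial_eq_0)

lemma binomial_drop_two_2:
  "real (n choose r) * (real (n + 2) * real (n + 1)) \<le> real ((n + 2) choose (r + 2)) * (real (r + 2))\<^sup>2"
proof -
  have 1: "real (r + 2) * real ((n + 2) choose (r + 2)) = real (n + 2) * real ((n + 1) choose (r + 1))"
    unfolding of_nat_mult[symmetric] of_nat_eq_iff
    using binomial_absorption[of "r + 1" "n + 2"] by (simp del: binomial_Suc_Suc)
  have 2: "real (r + 1) * real ((n + 1) choose (r + 1)) = real (n + 1) * real (n choose r)"
    unfolding of_nat_mult[symmetric] of_nat_eq_iff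
    using binomial_absorption[of r "n + 1"] by (simp del: binomial_Suc_Suc)
  have "real (n choose r) * (real (n + 2) * real (n + 1)) =
      real (n + 2) * (real (r + 1) * real ((n + 1) choose (r + 1)))"
    unfolding 2 by (simp add: algebra_simps)
  also have "\<dots> = real (r + 1) * (real (n + 2) * real ((n + 1) choose (r + 1)))"
    by (simp only: mult_ac)
  also have "\<dots> = real (r + 1) * (real (r + 2) * real ((n + 2) choose (r + 2)))"
    by (simp only: 1)
  also have "\<dots> \<le> real (r + 2) * (real (r + 2) * real ((n + 2) choose (r + 2)))"
    by (intro mult_right_mono) auto
  finally show ?thesis by (simp only: power2_eq_square mult_ac)
qed

text \<open>Induction on \<open>k\<close>: one more factor \<open>1 + x^2\<close> adds the
  coefficients at \<open>r\<close> and \<open>r - 2\<close>, and the two preceding estimates turn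
  them into the two squares of the base, times a single binomial coefficient.\<close>

lemma coeff_pair_poly_le:
  "coeff ([:1, 0, 1:] ^ k * [:1, 1:] ^ m) r * real m ^ (2 * k) \<le>
     real ((m + 2 * k) choose r) * ((real r)\<^sup>2 + (real (m + 2 * k) - real r)\<^sup>2) ^ k"
proof (induction k arbitrary: r)
  case 0
  then show ?case using kraw_0[of m r] by (simp add: kraw_def)
next
  case (Suc k)
  define n where "n = m + 2 * k"
  define Q where "Q = [:1, 0, 1:] ^ k * [:1, 1 :: real:] ^ m"
  define T where "T = (real r)\<^sup>2 + (real (n + 2) - real r)\<^sup>2"
  have T0: "T \<ge> 0" by (simp add: T_def)
  \<comment> \<open>The power of \<open>m\<close> on the left is absorbed by the product
    \<open>(n + 2) (n + 1)\<close> of the binomial estimates, one \<open>m^2\<close> per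
    step.\<close>
  have mn: "(real m)\<^sup>2 \<le> real (n + 2) * real (n + 1)"
    unfolding power2_eq_square n_def by (intro mult_mono) auto
  \<comment> \<open>For \<open>r \<le> n\<close> the base grows when \<open>n\<close> becomes
    \<open>n + 2\<close>. For \<open>r > n\<close> this can fail, but then the binomial coefficient
    is 0.\<close>
  have IH0: "coeff Q r * real m ^ (2 * k) \<le> real (n choose r) * T ^ k"
  proof (cases "r \<le> n")
    case True
    have "coeff Q r * real m ^ (2 * k) \<le>
        real (n choose r) * ((real r)\<^sup>2 + (real n - real r)\<^sup>2) ^ k"
      using Suc.IH[of r] by (simp add: Q_def n_def)
    also have "\<dots> \<le> real (n choose r) * T ^ k"
      unfolding T_def using True by (intro mult_left_mono power_mono add_left_mono) auto
    finally show ?thesis .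
  next
    case False
    then have "n choose r = 0" by simp
    moreover have "coeff Q r * real m ^ (2 * k) \<le>
        real (n choose r) * ((real r)\<^sup>2 + (real n - real r)\<^sup>2) ^ k"
      using Suc.IH[of r] by (simp add: Q_def n_def)
    ultimately show ?thesis by (simp only: of_nat_0 mult_zero_left)
  qed
  have le0: "coeff Q r * real m ^ (2 * Suc k) \<le>
      real ((n + 2) choose r) * (real (n + 2) - real r)\<^sup>2 * T ^ k"
  proof -
    have "coeff Q r * real m ^ (2 * Suc k) = coeff Q r * real m ^ (2 * k) * (real m)\<^sup>2"
      by (simp add: power2_eq_square)
    also have "\<dots> \<le> real (n choose r) * T ^ k * (real (n + 2) * real (n + 1))"
      by (intro mult_mono IH0 mn) (use T0 in auto)
    also have "\<dots> = real (n choose r) * (real (n + 2) * real (n + 1)) * T ^ k"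
      by (simp only: mult_ac)
    also have "\<dots> \<le> real ((n + 2) choose r) * (real (n + 2) - real r)\<^sup>2 * T ^ k"
      by (intro mult_right_mono binomial_drop_two_0) (use T0 in auto)
    finally show ?thesis .
  qed
  have le2: "coeff (monom 1 2 * Q) r * real m ^ (2 * Suc k) \<le>
      real ((n + 2) choose r) * (real r)\<^sup>2 * T ^ k"
  proof (cases "r < 2")
    case True
    then show ?thesis using T0 by (simp add: coeff_monom_mult)
  next
    case False
    then obtain s where s: "r = s + 2" by (metis add.commute le_Suc_ex not_less)
    have "coeff Q s * real m ^ (2 * k) \<le>
        real (n choose s) * ((real s)\<^sup>2 + (real n - real s)\<^sup>2) ^ k"
      using Suc.IH[of s] by (simp add: Q_def n_def)
    also have "\<dots> \<le> real (n choose s) * T ^ k"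
    proof -
      \<comment> \<open>Here \<open>n - s\<close> equals \<open>n + 2 - r\<close>, so only the first
        square changes.\<close>
      have "(real s)\<^sup>2 + (real n - real s)\<^sup>2 \<le> T" by (simp add: T_def s power_mono)
      then show ?thesis by (intro mult_left_mono power_mono) auto
    qed
    finally have IH2: "coeff Q s * real m ^ (2 * k) \<le> real (n choose s) * T ^ k" .
    have "coeff Q s * real m ^ (2 * Suc k) = coeff Q s * real m ^ (2 * k) * (real m)\<^sup>2"
      by (simp add: power2_eq_square)
    also have "\<dots> \<le> real (n choose s) * T ^ k * (real (n + 2) * real (n + 1))"
      by (intro mult_mono IH2 mn) (use T0 in auto)
    also have "\<dots> = real (n choose s) * (real (n + 2) * real (n + 1)) * T ^ k"
      by (simp only: mult_ac)
    also have "\<dots> \<le> real ((n + 2) choose (s + 2)) * (real (s + 2))\<^sup>2 * T ^ k"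
      by (intro mult_right_mono binomial_drop_two_2) (use T0 in auto)
    finally show ?thesis by (simp add: s coeff_monom_mult)
  qed
  have "[:1, 0, 1:] ^ Suc k * [:1, 1:] ^ m = Q + monom 1 2 * Q"
  proof -
    have "[:1, 0, 1 :: real:] = 1 + monom 1 2"
      by (simp add: monom_altdef numeral_2_eq_2 one_pCons)
    then show ?thesis by (simp add: Q_def algebra_simps)
  qed
  then have "coeff ([:1, 0, 1:] ^ Suc k * [:1, 1:] ^ m) r * real m ^ (2 * Suc k) =
      coeff Q r * real m ^ (2 * Suc k) + coeff (monom 1 2 * Q) r * real m ^ (2 * Suc k)"
    by (simp only: coeff_add distrib_right)
  also have "\<dots> \<le> real ((n + 2) choose r) * (real (n + 2) - real r)\<^sup>2 * T ^ k +
      real ((n + 2) choose r) * (real r)\<^sup>2 * T ^ k"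
    by (rule add_mono[OF le0 le2])
  also have "\<dots> = real ((n + 2) choose r) * T ^ Suc k"
    by (simp only: power_Suc) (simp add: T_def algebra_simps)
  finally show ?case by (simp add: T_def n_def)
qed

text \<open>For fixed \<open>k\<^sub>0\<close> the first factor tends to 1 as \<open>n\<close>
  grows, while the base of the second is below 1 for \<open>0 < r < n\<close>; a large
  \<open>k\<^sub>0\<close> therefore makes the middle range small.\<close>

lemma abs_normalized_kraw_le:
  assumes "k\<^sub>0 \<le> k" "k + k\<^sub>0 \<le> n" "2 * k\<^sub>0 < n" "r \<le> n"
  shows "\<bar>kraw n k r / real (n choose r)\<bar> \<le>
    (real n / (real n - 2 * real k\<^sub>0)) ^ (2 * k\<^sub>0) *
      ((real r / real n)\<^sup>2 + (1 - real r / real n)\<^sup>2) ^ k\<^sub>0"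
proof -
  define m where "m = n - 2 * k\<^sub>0"
  have n: "n = m + 2 * k\<^sub>0" and m: "0 < m" using assms by (auto simp: m_def)
  have C: "real (n choose r) > 0" using assms by simp
  have "\<bar>kraw n k r\<bar> * real m ^ (2 * k\<^sub>0) \<le>
      coeff ([:1, 0, 1:] ^ k\<^sub>0 * [:1, 1:] ^ m) r * real m ^ (2 * k\<^sub>0)"
    using abs_kraw_le_coeff[of k\<^sub>0 k n r] assms by (intro mult_right_mono) (auto simp: m_def)
  also have "\<dots> \<le> real (n choose r) * ((real r)\<^sup>2 + (real n - real r)\<^sup>2) ^ k\<^sub>0"
    using coeff_pair_poly_le[of k\<^sub>0 m r] by (simp add: n)
  also have "(real r)\<^sup>2 + (real n - real r)\<^sup>2 =
      (real n)\<^sup>2 * ((real r / real n)\<^sup>2 + (1 - real r / real n)\<^sup>2)"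
    using assms by (simp add: field_simps power2_eq_square)
  finally have "\<bar>kraw n k r\<bar> * real m ^ (2 * k\<^sub>0) \<le> real (n choose r) *
      (real n ^ (2 * k\<^sub>0) * ((real r / real n)\<^sup>2 + (1 - real r / real n)\<^sup>2) ^ k\<^sub>0)"
    by (simp only: power_mult_distrib power_mult)
  moreover have "real n - 2 * real k\<^sub>0 = real m" by (simp add: n)
  ultimately show ?thesis
    using C m by (simp add: power_divide abs_divide field_simps)
qed

text \<open>By the recurrence, \<open>\<kappa> (j + 2) - \<rho> * \<kappa> (j + 1)\<close> is
  \<open>(j + 1) / (m + 1)\<close> times a bounded quantity, so \<kappa> is nearly geometric. For
  \<open>2 * k \<le> n\<close> the denominators stay above \<open>n / 2\<close>, and the errors
  accumulate quadratically in \<open>k\<close>.\<close>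

lemma normalized_kraw_near_power:
  assumes "0 < n" "r \<le> n" "2 * k \<le> n"
  shows "\<bar>kraw n k r / real (n choose r) - (1 - 2 * (real r / real n)) ^ k\<bar> \<le> 4 * (real k)\<^sup>2 / real n"
proof -
  define \<kappa> where "\<kappa> = (\<lambda>k. kraw n k r / real (n choose r))"
  define \<rho> where "\<rho> = 1 - 2 * (real r / real n)"
  have C: "real (n choose r) > 0" using assms by simp
  have \<kappa>1: "\<bar>\<kappa> k\<bar> \<le> 1" if "k \<le> n" for k
    using abs_kraw_le_binomial[OF that, of r] C by (simp add: \<kappa>_def)
  have \<rho>1: "\<bar>\<rho>\<bar> \<le> 1"
    using assms by (simp add: \<rho>_def abs_le_iff field_simps)
  have "2 * k \<le> n \<longrightarrow> \<bar>\<kappa> k - \<rho> ^ k\<bar> \<le> 4 * (real k)\<^sup>2 / real n" for k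
  proof (induction k rule: less_induct)
    case (less k)
    show ?case
    proof
      assume kn: "2 * k \<le> n"
      consider "k = 0" | "k = 1" | j where "k = j + 2"
        by (metis One_nat_def add_2_eq_Suc' not0_implies_Suc)
      then show "\<bar>\<kappa> k - \<rho> ^ k\<bar> \<le> 4 * (real k)\<^sup>2 / real n"
      proof cases
        case 1
        then show ?thesis using C by (simp add: \<kappa>_def kraw_0)
      next
        case 2
        obtain m where "n = Suc m" using assms by (cases n) auto
        then have "\<kappa> 1 = \<rho>"
          using kraw_1[of m r] C assms kraw_0[of n r] by (simp add: \<kappa>_def \<rho>_def field_simps)
        then show ?thesis using 2 by simp
      next
        case (3 j)
        define m where "m = n - (j + 2)"
        have n: "n = j + m + 2" using kn 3 by (simp add: m_def)
        have rec: "real (Suc m) * \<kappa> (j + 2) + real (Suc j) * \<kappa> j = real n * \<rho> * \<kappa> (Suc j)"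
        proof -
          have "real n * \<rho> = real n - 2 * real r"
            using assms by (simp add: \<rho>_def field_simps)
          then show ?thesis
            using arg_cong[OF kraw_recurrence[of m j r], of "\<lambda>x. x / real (n choose r)"]
            by (simp add: \<kappa>_def n add_divide_distrib)
        qed
        \<comment> \<open>The right-hand side of the recurrence is split by
          \<open>n = Suc m + Suc j\<close>.\<close>
        have "real (Suc m) * (\<kappa> (j + 2) - \<rho> * \<kappa> (Suc j)) =
            real (Suc j) * (\<rho> * \<kappa> (Suc j) - \<kappa> j)"
          using rec by (simp add: n algebra_simps)
        then have "\<kappa> (j + 2) - \<rho> * \<kappa> (Suc j) =
            real (Suc j) / real (Suc m) * (\<rho> * \<kappa> (Suc j) - \<kappa> j)"
          by (simp add: field_simps)
        moreover have "\<bar>\<rho> * \<kappa> (Suc j) - \<kappa> j\<bar> \<le> 2"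
        proof -
          have "\<bar>\<rho> * \<kappa> (Suc j)\<bar> \<le> 1 * 1"
            unfolding abs_mult using \<rho>1 \<kappa>1[of "Suc j"] n by (intro mult_mono) auto
          then show ?thesis using \<kappa>1[of j] n by linarith
        qed
        ultimately have "\<bar>\<kappa> (j + 2) - \<rho> * \<kappa> (Suc j)\<bar> \<le> real (Suc j) / real (Suc m) * 2"
          by (simp only: abs_mult abs_divide abs_of_nat) (intro mult_left_mono, auto)
        also have "\<dots> \<le> 4 * real (Suc j) / real n"
        proof -
          have "real n \<le> 2 * real (Suc m)" using kn 3 n by simp
          then have "real (Suc j) * 2 * real n \<le> real (Suc j) * 2 * (2 * real (Suc m))"
            by (intro mult_left_mono) auto
          then show ?thesis using assms by (simp add: field_simps)
        qed
        finally have step: "\<bar>\<kappa> (j + 2) - \<rho> * \<kappa> (Suc j)\<bar> \<le> 4 * real (Suc j) / real n" .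
        have "\<bar>\<rho> * \<kappa> (Suc j) - \<rho> ^ (j + 2)\<bar> = \<bar>\<rho>\<bar> * \<bar>\<kappa> (Suc j) - \<rho> ^ Suc j\<bar>"
          by (simp add: abs_mult[symmetric] algebra_simps)
        also have "\<dots> \<le> 1 * (4 * (real (Suc j))\<^sup>2 / real n)"
          using \<rho>1 less[of "Suc j"] kn 3 by (intro mult_mono) auto
        finally have "\<bar>\<kappa> (j + 2) - \<rho> ^ (j + 2)\<bar> \<le>
            4 * real (Suc j) / real n + 4 * (real (Suc j))\<^sup>2 / real n"
          using step by linarith
        \<comment> \<open>Since \<open>(j + 1) + (j + 1)^2 = (j + 1) (j + 2)\<close>.\<close>
        also have "\<dots> \<le> 4 * (real (j + 2))\<^sup>2 / real n"
          unfolding add_divide_distrib[symmetric]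
          by (intro divide_right_mono) (auto simp: power2_eq_square algebra_simps)
        finally show ?thesis using 3 by simp
      qed
    qed
  qed
  then show ?thesis using assms by (simp add: \<kappa>_def \<rho>_def)
qed

text \<open>The order of choices gives uniformity in \<open>r\<close> and \<open>k\<close>: \<delta>
  fixes a contraction factor \<theta>, then \<epsilon> fixes the width \<open>k\<^sub>0\<close> of
  the two end ranges, and only then is \<open>N\<close> taken large.\<close>

lemma normalized_kraw_uniform_limit:
  assumes \<delta>: "0 < \<delta>" "\<delta> < 1/2" and \<epsilon>: "0 < \<epsilon>"
  shows "\<exists>N. \<forall>n\<ge>N. \<forall>r k. real r / real n \<in> {\<delta>..1/2 - \<delta>} \<longrightarrow> k \<le> n \<longrightarrow>
    \<bar>kraw n k r / real (n choose r) - ((1 - 2 * (real r / real n)) ^ k +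
      (-1) ^ r * (1 - 2 * (real r / real n)) ^ (n - k))\<bar> \<le> \<epsilon>"
proof -
  \<comment> \<open>The largest value of \<open>\<beta>^2 + (1 - \<beta>)^2\<close> on the
    admissible interval, attained at its left end; it also dominates \<rho>.\<close>
  define \<theta> where "\<theta> = \<delta>\<^sup>2 + (1 - \<delta>)\<^sup>2"
  have "\<theta> = 1 - 2 * (\<delta> * (1 - \<delta>))"
    by (simp add: \<theta>_def power2_eq_square algebra_simps)
  moreover have "0 < \<delta> * (1 - \<delta>)" using \<delta> by simp
  ultimately have \<theta>: "\<theta> < 1" "0 \<le> \<theta>" by linarith (simp add: \<theta>_def)
  obtain k\<^sub>0 where k\<^sub>0: "\<theta> ^ k\<^sub>0 < \<epsilon> / 8"
    using real_arch_pow_inv[of "\<epsilon> / 8" \<theta>] \<theta> \<epsilon> by auto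
  have "(\<lambda>n. (real n / (real n - 2 * real k\<^sub>0)) ^ (2 * k\<^sub>0)) \<longlonglongrightarrow> 1 ^ (2 * k\<^sub>0)"
    by (intro tendsto_power) real_asymp
  then have ev1: "\<forall>\<^sub>F n in sequentially. (real n / (real n - 2 * real k\<^sub>0)) ^ (2 * k\<^sub>0) < 2"
    by (rule order_tendstoD) simp
  have "(\<lambda>n. 4 * (real k\<^sub>0)\<^sup>2 / real n) \<longlonglongrightarrow> 0" by real_asymp
  then have ev2: "\<forall>\<^sub>F n in sequentially. 4 * (real k\<^sub>0)\<^sup>2 / real n < \<epsilon> / 2"
    by (rule order_tendstoD) (use \<epsilon> in simp)
  have ev3: "\<forall>\<^sub>F n in sequentially. 2 * k\<^sub>0 < n"
    by (rule eventually_gt_at_top)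
  obtain N where N: "\<And>n. n \<ge> N \<Longrightarrow> (real n / (real n - 2 * real k\<^sub>0)) ^ (2 * k\<^sub>0) < 2"
      "\<And>n. n \<ge> N \<Longrightarrow> 4 * (real k\<^sub>0)\<^sup>2 / real n < \<epsilon> / 2" "\<And>n. n \<ge> N \<Longrightarrow> 2 * k\<^sub>0 < n"
    using eventually_conj[OF ev1 eventually_conj[OF ev2 ev3]]
    unfolding eventually_sequentially by blast
  show ?thesis
  proof (intro exI[of _ N] allI impI)
    fix n r k :: nat
    assume n: "N \<le> n" and r: "real r / real n \<in> {\<delta>..1/2 - \<delta>}" and k: "k \<le> n"
    define \<beta> where "\<beta> = real r / real n"
    define \<rho> where "\<rho> = 1 - 2 * \<beta>"
    define \<kappa> where "\<kappa> = (\<lambda>k. kraw n k r / real (n choose r))"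
    have n0: "0 < n" using r \<delta> by (cases "n = 0") auto
    have \<beta>: "\<delta> \<le> \<beta>" "\<beta> \<le> 1/2 - \<delta>" using r by (auto simp: \<beta>_def)
    have rn: "r \<le> n"
    proof -
      have "real r / real n \<le> 1" using \<beta> \<delta> by (simp add: \<beta>_def)
      then show ?thesis using n0 by simp
    qed
    \<comment> \<open>The product is half of
      \<open>\<theta> - (\<beta>^2 + (1 - \<beta>)^2)\<close>.\<close>
    have "0 \<le> (\<beta> - \<delta>) * (1 - \<delta> - \<beta>)" using \<beta> \<delta> by (intro mult_nonneg_nonneg) auto
    then have \<beta>\<theta>: "\<beta>\<^sup>2 + (1 - \<beta>)\<^sup>2 \<le> \<theta>"
      by (simp add: \<theta>_def power2_eq_square algebra_simps)
    have \<rho>: "0 \<le> \<rho>" "\<rho> \<le> \<theta>"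
    proof -
      show "0 \<le> \<rho>" using \<beta> \<delta> by (simp add: \<rho>_def)
      have "\<theta> - (1 - 2 * \<delta>) = 2 * \<delta>\<^sup>2" by (simp add: \<theta>_def power2_eq_square algebra_simps)
      then have "1 - 2 * \<delta> \<le> \<theta>" by (smt (verit) zero_le_power2)
      then show "\<rho> \<le> \<theta>" using \<beta> by (simp add: \<rho>_def)
    qed
    have \<rho>_power: "0 \<le> \<rho> ^ i \<and> \<rho> ^ i \<le> \<epsilon> / 8" if "k\<^sub>0 \<le> i" for i
    proof -
      have "\<rho> ^ i \<le> \<theta> ^ i" using \<rho> by (intro power_mono)
      also have "\<dots> \<le> \<theta> ^ k\<^sub>0" using \<theta> that by (intro power_decreasing) auto
      finally show ?thesis using k\<^sub>0 \<rho> by simp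
    qed
    \<comment> \<open>Near degree 0 the power \<open>\<rho> ^ i\<close> is the main term; the
      reflected power is negligible because \<open>2 * k\<^sub>0 < n\<close> forces
      \<open>k\<^sub>0 \<le> n - i\<close>.\<close>
    have low: "\<bar>\<kappa> i - (\<rho> ^ i + (-1) ^ r * \<rho> ^ (n - i))\<bar> \<le> \<epsilon>" if "i < k\<^sub>0" for i
    proof -
      have "\<bar>\<kappa> i - \<rho> ^ i\<bar> \<le> 4 * (real i)\<^sup>2 / real n"
        using normalized_kraw_near_power[of n r i] n0 rn that N(3)[OF n]
        by (simp add: \<kappa>_def \<rho>_def \<beta>_def)
      also have "\<dots> \<le> 4 * (real k\<^sub>0)\<^sup>2 / real n"
        using that by (intro divide_right_mono mult_left_mono power_mono) auto
      also have "\<dots> \<le> \<epsilon> / 2" using N(2)[OF n] by simp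
      finally have "\<bar>\<kappa> i - \<rho> ^ i\<bar> \<le> \<epsilon> / 2" .
      moreover have "\<bar>(-1) ^ r * \<rho> ^ (n - i)\<bar> \<le> \<epsilon> / 8"
        using \<rho>_power[of "n - i"] \<rho>(1) that N(3)[OF n] by (simp add: abs_mult power_abs)
      ultimately show ?thesis using \<epsilon> by linarith
    qed
    have "\<bar>\<kappa> k - (\<rho> ^ k + (-1) ^ r * \<rho> ^ (n - k))\<bar> \<le> \<epsilon>"
    proof -
      consider "k < k\<^sub>0" | "n - k < k\<^sub>0" | "k\<^sub>0 \<le> k" "k + k\<^sub>0 \<le> n" using k by linarith
      then show ?thesis
      proof cases
        case 1
        then show ?thesis by (rule low)
      next
        case 2
        \<comment> \<open>Reflection exchanges the two powers up to the sign
          \<open>(-1) ^ r\<close>, so the top range reduces to the bottom one.\<close>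
        have "\<kappa> k = (-1) ^ r * \<kappa> (n - k)"
          using kraw_symmetric[of "n - k" n r] k by (simp add: \<kappa>_def)
        then have "\<kappa> k - (\<rho> ^ k + (-1) ^ r * \<rho> ^ (n - k)) =
            (-1) ^ r * (\<kappa> (n - k) - (\<rho> ^ (n - k) + (-1) ^ r * \<rho> ^ (n - (n - k))))"
          using k by (simp add: algebra_simps flip: power_add mult_2)
        then show ?thesis using low[OF 2] by (simp add: abs_mult power_abs)
      next
        case 3
        \<comment> \<open>In the middle range the three terms are small separately: \<epsilon>/4,
          \<epsilon>/8 and \<epsilon>/8.\<close>
        have "\<bar>\<kappa> k\<bar> \<le> (real n / (real n - 2 * real k\<^sub>0)) ^ (2 * k\<^sub>0) * (\<beta>\<^sup>2 + (1 - \<beta>)\<^sup>2) ^ k\<^sub>0"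
          using abs_normalized_kraw_le[OF 3 N(3)[OF n] rn] by (simp add: \<kappa>_def \<beta>_def)
        also have "\<dots> \<le> 2 * \<theta> ^ k\<^sub>0"
          using N(1)[OF n] \<beta>\<theta> by (intro mult_mono power_mono) auto
        finally have "\<bar>\<kappa> k\<bar> \<le> \<epsilon> / 4" using k\<^sub>0 by simp
        moreover have "\<bar>(-1) ^ r * \<rho> ^ (n - k)\<bar> \<le> \<epsilon> / 8"
          using \<rho>_power[of "n - k"] \<rho>(1) 3 by (simp add: abs_mult power_abs)
        ultimately show ?thesis using \<rho>_power[of k] 3 \<epsilon> by linarith
      qed
    qed
    then show "\<bar>kraw n k r / real (n choose r) - ((1 - 2 * (real r / real n)) ^ k +
        (-1) ^ r * (1 - 2 * (real r / real n)) ^ (n - k))\<bar> \<le> \<epsilon>"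
      by (simp add: \<kappa>_def \<rho>_def \<beta>_def)
  qed
qed

section \<open>Size of a sphere relative to its ball\<close>

lemma binomial_ratio: "real (Suc j) * real (n choose Suc j) = (real n - real j) * real (n choose j)"
proof (cases "j \<le> n")
  case True
  then show ?thesis
    using binomial_absorption[of j n] binomial_absorb_comp[of n j]
    by (metis of_nat_diff of_nat_mult)
qed (simp add: binomial_eq_0)

text \<open>Each summand is \<open>(n - j) (n choose j) - j (n choose j)\<close>, and
  \<open>binomial_ratio\<close> identifies the first part with the second part at
  \<open>j + 1\<close>, so the sum telescopes.\<close>

lemma weighted_binomial_sum:
  "(\<Sum>j\<le>r. (real n - 2 * real j) * real (n choose j)) = (real n - real r) * real (n choose r)"
proof (induction r)
  case (Suc r)
  then show ?case using binomial_ratio[of r n] by (simp add: algebra_simps)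
qed simp

text \<open>The telescoped sum gives \<open>(n - r) (n choose r) = (n - 2 r) B + 2 D\<close>, where
  \<open>D\<close> weights each layer by its depth \<open>r - j\<close>. Binomial coefficients decay
  geometrically below \<open>r\<close>, so \<open>D\<close> is at most a constant times
  \<open>B\<close> and disappears after division by \<open>n\<close>.\<close>

lemma ball_profile_ratio:
  assumes \<delta>: "0 < \<delta>" "\<delta> < 1/2" and r: "real r / real n \<in> {\<delta>..1/2 - \<delta>}"
  defines "B \<equiv> (\<Sum>j\<le>r. real (n choose j))"
  shows "\<bar>(1 - real r / real n) * (real (n choose r) / B) - (1 - 2 * (real r / real n))\<bar> \<le>
    (1/2 - \<delta>) / \<delta> / real n"
proof -
  \<comment> \<open>\<open>q\<close> will bound the ratio of consecutive binomial coefficients up to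
    \<open>r\<close>, and \<open>c = q / (1 - q)\<close> is the mean depth of a geometric profile
    with that ratio, the fixed point of \<open>c = (c + 1) * q\<close>.\<close>
  define c where "c = (1/2 - \<delta>) / (2 * \<delta>)"
  define q where "q = (1/2 - \<delta>) / (1/2 + \<delta>)"
  have "c + 1 = (1/2 + \<delta>) / (2 * \<delta>)"
    using \<delta> by (simp add: c_def field_simps)
  then have cq: "(c + 1) * q = c" "0 \<le> q" "0 \<le> c"
    using \<delta> by (auto simp: c_def q_def)
  have n0: "0 < n" using r \<delta> by (cases "n = 0") auto
  have rn: "real r \<le> (1/2 - \<delta>) * real n" using r n0 by (simp add: field_simps)
  have ratio: "real (n choose j) \<le> q * real (n choose Suc j)" if "Suc j \<le> r" for j
  proof -
    have j: "real j + 1 \<le> real r" using that by linarith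
    have pos: "0 < real n - real j"
    proof -
      have "(1/2 - \<delta>) * real n \<le> 1 * real n" using \<delta> by (intro mult_right_mono) auto
      then show ?thesis using j rn by linarith
    qed
    have "(real j + 1) * (1/2 + \<delta>) \<le> (1/2 - \<delta>) * (real n - real j)"
    proof -
      have "(real j + 1) * (1/2 + \<delta>) + (1/2 - \<delta>) * real j = real j + 1/2 + \<delta>"
        by (simp add: field_simps)
      also have "\<dots> \<le> real r" using j \<delta> by linarith
      finally have "(real j + 1) * (1/2 + \<delta>) \<le> (1/2 - \<delta>) * real n - (1/2 - \<delta>) * real j"
        using rn by linarith
      then show ?thesis by (simp only: right_diff_distrib)
    qed
    then have "real j + 1 \<le> q * (real n - real j)"
      using \<delta> by (simp add: q_def field_simps)
    then have "(real j + 1) * real (n choose Suc j) \<le>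
        q * (real n - real j) * real (n choose Suc j)"
      by (intro mult_right_mono) auto
    then have "(real n - real j) * real (n choose j) \<le>
        (real n - real j) * (q * real (n choose Suc j))"
      using binomial_ratio[of j n] by (simp add: algebra_simps)
    then show ?thesis using pos by simp
  qed
  \<comment> \<open>Passing from \<open>i\<close> to \<open>Suc i\<close> deepens every layer by
    one. This adds the size of the ball of radius \<open>i\<close>, which is at most
    \<open>q\<close> times that of the new ball.\<close>
  have "(\<Sum>j\<le>i. (real i - real j) * real (n choose j)) \<le> c * (\<Sum>j\<le>i. real (n choose j))"
    if "i \<le> r" for i
    using that
  proof (induction i)
    case 0
    then show ?case using cq by simp
  next
    case (Suc i)
    have "(\<Sum>j\<le>i. real (n choose j)) \<le> (\<Sum>j\<le>i. q * real (n choose Suc j))"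
      using Suc.prems by (intro sum_mono ratio) auto
    also have "\<dots> \<le> q * (\<Sum>j\<le>Suc i. real (n choose j))"
      using cq by (subst sum.atMost_Suc_shift) (simp add: sum_distrib_left distrib_left)
    finally have Bi: "(\<Sum>j\<le>i. real (n choose j)) \<le> q * (\<Sum>j\<le>Suc i. real (n choose j))" .
    have "(\<Sum>j\<le>Suc i. (real (Suc i) - real j) * real (n choose j)) =
        (\<Sum>j\<le>i. (real i - real j) * real (n choose j)) + (\<Sum>j\<le>i. real (n choose j))"
      by (simp add: algebra_simps flip: sum.distrib)
    also have "\<dots> \<le> (c + 1) * (\<Sum>j\<le>i. real (n choose j))"
      using Suc by (simp add: algebra_simps)
    also have "\<dots> \<le> (c + 1) * (q * (\<Sum>j\<le>Suc i. real (n choose j)))"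
      using Bi cq by (intro mult_left_mono) auto
    also have "\<dots> = c * (\<Sum>j\<le>Suc i. real (n choose j))"
      using cq by (simp only: mult.assoc[symmetric])
    finally show ?case .
  qed
  then have D: "(\<Sum>j\<le>r. (real r - real j) * real (n choose j)) \<le> c * B"
    by (simp add: B_def)
  have D0: "0 \<le> (\<Sum>j\<le>r. (real r - real j) * real (n choose j))"
    by (intro sum_nonneg) auto
  define D where "D = (\<Sum>j\<le>r. (real r - real j) * real (n choose j))"
  have "(real n - real r) * real (n choose r) = (real n - 2 * real r) * B + 2 * D"
    unfolding weighted_binomial_sum[symmetric] B_def D_def sum_distrib_left sum.distrib[symmetric]
    by (intro sum.cong) (auto simp: algebra_simps)
  moreover have B: "0 < B"
  proof -
    have "real (n choose 0) \<le> B" unfolding B_def by (intro member_le_sum) auto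
    then show ?thesis by simp
  qed
  moreover have "(1 - real r / real n) * (real (n choose r) / B) - (1 - 2 * (real r / real n)) =
      ((real n - real r) * real (n choose r) - (real n - 2 * real r) * B) / B / real n"
    using n0 B by (simp add: diff_divide_distrib left_diff_distrib)
  ultimately have "(1 - real r / real n) * (real (n choose r) / B) - (1 - 2 * (real r / real n)) =
      2 * D / B / real n"
    by simp
  moreover have "2 * D / B / real n \<le> (1/2 - \<delta>) / \<delta> / real n"
    using D B by (intro divide_right_mono) (simp_all add: D_def c_def field_simps)
  moreover have "0 \<le> 2 * D / B / real n" using D0 B by (simp add: D_def)
  ultimately show ?thesis by simp
qed

text \<open>Adding the limits at \<open>k\<close> and \<open>k - 1\<close> gives
  \<open>1 + \<rho>\<close> times \<open>\<rho>^(k-1) + (-1)^r \<rho>^(n-k)\<close>. After division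
  the prefactor is close to \<rho> by \<open>ball_profile_ratio\<close>; this restores the exponent
  \<open>k\<close> and leaves an extra \<rho> on the reflected term.\<close>

lemma ball_kraw_uniform_limit:
  assumes \<delta>: "0 < \<delta>" "\<delta> < 1/2" and \<epsilon>: "0 < \<epsilon>"
  shows "\<exists>N. \<forall>n\<ge>N. \<forall>r k. real r / real n \<in> {\<delta>..1/2 - \<delta>} \<longrightarrow> 1 \<le> k \<longrightarrow> k \<le> n \<longrightarrow>
    \<bar>(kraw n k r + kraw n (k - 1) r) / (2 * (\<Sum>j\<le>r. real (n choose j))) -
      ((1 - 2 * (real r / real n)) ^ k + (-1) ^ r * (1 - 2 * (real r / real n)) *
        (1 - 2 * (real r / real n)) ^ (n - k))\<bar> \<le> \<epsilon>"
proof -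
  obtain N1 where N1: "\<And>n r k. n \<ge> N1 \<Longrightarrow> real r / real n \<in> {\<delta>..1/2 - \<delta>} \<Longrightarrow> k \<le> n \<Longrightarrow>
      \<bar>kraw n k r / real (n choose r) - ((1 - 2 * (real r / real n)) ^ k +
        (-1) ^ r * (1 - 2 * (real r / real n)) ^ (n - k))\<bar> \<le> \<epsilon> / 2"
    using normalized_kraw_uniform_limit[OF \<delta>, of "\<epsilon> / 2"] \<epsilon> by auto
  have "(\<lambda>n. (1/2 - \<delta>) / \<delta> / real n) \<longlonglongrightarrow> 0" by real_asymp
  then have "\<forall>\<^sub>F n in sequentially. (1/2 - \<delta>) / \<delta> / real n < \<epsilon> / 4"
    by (rule order_tendstoD) (use \<epsilon> in simp)
  then obtain N2 where N2: "\<And>n. n \<ge> N2 \<Longrightarrow> (1/2 - \<delta>) / \<delta> / real n < \<epsilon> / 4"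
    unfolding eventually_sequentially by blast
  show ?thesis
  proof (intro exI[of _ "max N1 N2"] allI impI)
    fix n r k :: nat
    assume n: "max N1 N2 \<le> n" and r: "real r / real n \<in> {\<delta>..1/2 - \<delta>}" and k: "1 \<le> k" "k \<le> n"
    define \<rho> where "\<rho> = 1 - 2 * (real r / real n)"
    define s :: real where "s = (-1) ^ r"
    define B where "B = (\<Sum>j\<le>r. real (n choose j))"
    define C where "C = real (n choose r)"
    define e where "e = (\<lambda>k. kraw n k r / C - (\<rho> ^ k + s * \<rho> ^ (n - k)))"
    define \<eta> where "\<eta> = (1 - real r / real n) * (C / B) - \<rho>"
    have n0: "0 < n" using r \<delta> by (cases "n = 0") auto
    have "real r / real n \<le> 1" using r \<delta> by simp
    then have "r \<le> n" using n0 by simp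
    then have C: "0 < C" by (simp add: C_def)
    have CB: "C \<le> B" unfolding B_def C_def by (intro member_le_sum) auto
    have s: "\<bar>s\<bar> = 1" by (simp add: s_def power_abs)
    have e: "\<bar>e k\<bar> \<le> \<epsilon> / 2" if "k \<le> n" for k
      using N1[OF _ r that] n by (simp add: e_def \<rho>_def s_def C_def)
    have \<eta>: "\<bar>\<eta>\<bar> \<le> \<epsilon> / 4"
    proof -
      have "N2 \<le> n" using n by simp
      from N2[OF this] ball_profile_ratio[OF \<delta> r] show ?thesis
        unfolding \<eta>_def \<rho>_def B_def C_def by linarith
    qed
    have \<rho>: "0 \<le> \<rho>" "\<rho> \<le> 1" using r \<delta> by (auto simp: \<rho>_def)
    obtain l where l: "k = Suc l" using k by (cases k) auto
    have nl: "n - l = Suc (n - k)" using k l by simp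
    have K: "kraw n i r = C * (\<rho> ^ i + s * \<rho> ^ (n - i) + e i)" for i
      using C by (simp add: e_def)
    have \<rho>\<eta>: "(1 + \<rho>) * C / (2 * B) = \<rho> + \<eta>"
    proof -
      have "1 + \<rho> = 2 * (1 - real r / real n)" by (simp add: \<rho>_def)
      moreover have "2 * x * C / (2 * B) = x * (C / B)" for x by simp
      ultimately show ?thesis by (simp only: \<eta>_def)
    qed
    have "kraw n k r + kraw n (k - 1) r =
        (1 + \<rho>) * C * (\<rho> ^ l + s * \<rho> ^ (n - k)) + C * (e k + e l)"
      unfolding K using nl by (simp add: l algebra_simps)
    then have "(kraw n k r + kraw n (k - 1) r) / (2 * B) =
        (1 + \<rho>) * C / (2 * B) * (\<rho> ^ l + s * \<rho> ^ (n - k)) + C / B * ((e k + e l) / 2)"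
      by (simp add: add_divide_distrib distrib_left)
    then have "(kraw n k r + kraw n (k - 1) r) / (2 * B) - (\<rho> ^ k + s * \<rho> * \<rho> ^ (n - k)) =
        \<eta> * (\<rho> ^ l + s * \<rho> ^ (n - k)) + C / B * ((e k + e l) / 2)"
      unfolding \<rho>\<eta> by (simp add: l algebra_simps)
    moreover have "\<bar>\<eta> * (\<rho> ^ l + s * \<rho> ^ (n - k))\<bar> \<le> \<epsilon> / 4 * 2"
    proof -
      have "\<bar>\<rho> ^ l\<bar> \<le> 1" using \<rho> by (simp add: power_le_one)
      moreover have "\<bar>s * \<rho> ^ (n - k)\<bar> \<le> 1" using \<rho> s by (simp add: abs_mult power_le_one)
      ultimately have "\<bar>\<rho> ^ l + s * \<rho> ^ (n - k)\<bar> \<le> 2" by linarith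
      then show ?thesis unfolding abs_mult using \<eta> \<epsilon> by (intro mult_mono) auto
    qed
    moreover have "\<bar>C / B * ((e k + e l) / 2)\<bar> \<le> 1 * (\<epsilon> / 2)"
    proof -
      have "\<bar>C / B\<bar> \<le> 1" using C CB by simp
      moreover have "\<bar>(e k + e l) / 2\<bar> \<le> \<epsilon> / 2" using e[of k] e[of l] k l by force
      ultimately show ?thesis unfolding abs_mult by (intro mult_mono) auto
    qed
    ultimately have "\<bar>(kraw n k r + kraw n (k - 1) r) / (2 * B) -
        (\<rho> ^ k + s * \<rho> * \<rho> ^ (n - k))\<bar> \<le> \<epsilon> / 4 * 2 + 1 * (\<epsilon> / 2)"
      by (simp only: order_trans[OF abs_triangle_ineq add_mono])
    then show "\<bar>(kraw n k r + kraw n (k - 1) r) / (2 * (\<Sum>j\<le>r. real (n choose j))) -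
        ((1 - 2 * (real r / real n)) ^ k + (-1) ^ r * (1 - 2 * (real r / real n)) *
          (1 - 2 * (real r / real n)) ^ (n - k))\<bar> \<le> \<epsilon>"
      by (simp add: B_def \<rho>_def s_def)
  qed
qed

section \<open>The reflected stability\<close>

text \<open>The quantity \<open>D\<close> of the overview. It is defined spectrally, the form in
  which it enters the asymptotics; its probabilistic meaning is
  \<open>dual_stab_expectation\<close>.\<close>

definition dual_stab :: "nat \<Rightarrow> real \<Rightarrow> ((nat \<Rightarrow> real) \<Rightarrow> real) \<Rightarrow> real" where
  "dual_stab n \<beta> f =
     (\<Sum>S\<in>Pow {..<n}. (fourier_coeff n f S)\<^sup>2 * (1 - 2 * \<beta>) ^ (n - card S))"

lemma Stab_fourier:
  assumes "0 \<le> \<beta>" "\<beta> \<le> 1"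
  shows "Stab n \<beta> f = (\<Sum>S\<in>Pow {..<n}. (fourier_coeff n f S)\<^sup>2 * (1 - 2 * \<beta>) ^ card S)"
  unfolding Stab_def noise_stab_fourier[OF set_iid_noise_pmf]
  by (intro sum.cong refl) (simp add: expectation_iid_walsh assms)

lemma walsh_square:
  assumes "z \<in> cube n" "S \<subseteq> {..<n}"
  shows "walsh S z * walsh S z = 1"
proof -
  have "walsh S z * walsh S z = (\<Prod>i\<in>S. z i * z i)" by (simp add: prod.distrib)
  also have "\<dots> = 1"
  proof (intro prod.neutral ballI)
    fix i assume "i \<in> S"
    then have "z i = -1 \<or> z i = 1" using cube_values[OF assms(1), of i] assms(2) by auto
    then show "z i * z i = 1" by auto
  qed
  finally show ?thesis .
qed

lemma walsh_values: "z \<in> cube n \<Longrightarrow> S \<subseteq> {..<n} \<Longrightarrow> walsh S z = -1 \<or> walsh S z = 1"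
  using walsh_square[of z n S] by (auto simp: square_eq_1_iff)

lemma walsh_complement:
  assumes "z \<in> cube n" "S \<subseteq> {..<n}"
  shows "walsh S z * walsh {..<n} z = walsh ({..<n} - S) z"
proof -
  have "walsh {..<n} z = walsh ({..<n} - S) z * walsh S z"
    by (rule prod.subset_diff) (use assms in auto)
  then show ?thesis using walsh_square[OF assms] by (simp add: algebra_simps)
qed

text \<open>Multiplying by the full character sends \<open>S\<close> to its complement and so
  reflects the degree.\<close>

lemma dual_stab_expectation:
  assumes "0 \<le> \<beta>" "\<beta> \<le> 1"
  shows "dual_stab n \<beta> f =
    measure_pmf.expectation (iid_noise_pmf n \<beta>) (\<lambda>z. autocorr n f z * walsh {..<n} z)"
proof -
  let ?Q = "iid_noise_pmf n \<beta>"
  have "measure_pmf.expectation ?Q (\<lambda>z. autocorr n f z * walsh {..<n} z) =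
      (\<Sum>z\<in>cube n. \<Sum>S\<in>Pow {..<n}.
        (fourier_coeff n f S)\<^sup>2 * (walsh S z * walsh {..<n} z) * pmf ?Q z)"
    by (simp add: expectation_pmf_cube[OF set_iid_noise_pmf] autocorr_fourier sum_distrib_right
          mult.assoc)
  also have "\<dots> = (\<Sum>z\<in>cube n. \<Sum>S\<in>Pow {..<n}.
        (fourier_coeff n f S)\<^sup>2 * walsh ({..<n} - S) z * pmf ?Q z)"
    by (intro sum.cong refl) (simp add: walsh_complement)
  also have "\<dots> = (\<Sum>S\<in>Pow {..<n}. (fourier_coeff n f S)\<^sup>2 *
        measure_pmf.expectation ?Q (walsh ({..<n} - S)))"
    by (subst sum.swap) (simp add: expectation_pmf_cube[OF set_iid_noise_pmf] sum_distrib_left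
          mult.assoc)
  also have "\<dots> = dual_stab n \<beta> f"
    unfolding dual_stab_def
  proof (intro sum.cong refl)
    fix S assume "S \<in> Pow {..<n}"
    then have "card ({..<n} - S) = n - card S"
      by (subst card_Diff_subset) (auto intro: finite_subset)
    then show "(fourier_coeff n f S)\<^sup>2 * measure_pmf.expectation ?Q (walsh ({..<n} - S)) =
        (fourier_coeff n f S)\<^sup>2 * (1 - 2 * \<beta>) ^ (n - card S)"
      by (subst expectation_iid_walsh) (use assms in auto)
  qed
  finally show ?thesis by simp
qed

lemma dual_stab_nonneg: "\<beta> \<le> 1/2 \<Longrightarrow> 0 \<le> dual_stab n \<beta> f"
  unfolding dual_stab_def by (intro sum_nonneg mult_nonneg_nonneg zero_le_power2 zero_le_power[of "1 - 2 * \<beta>"]) auto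

text \<open>The autocorrelation is nonnegative, so replacing the parity sign by 1 can only increase
  the expectation.\<close>

lemma dual_stab_le_Stab:
  assumes "0 \<le> \<beta>" "\<beta> \<le> 1" "\<And>x. x \<in> cube n \<Longrightarrow> 0 \<le> f x"
  shows "dual_stab n \<beta> f \<le> Stab n \<beta> f"
proof -
  have "autocorr n f z * walsh {..<n} z * pmf Q z \<le> autocorr n f z * pmf Q z"
    if "z \<in> cube n" for z Q
  proof -
    have "autocorr n f z * walsh {..<n} z \<le> autocorr n f z * 1"
      using walsh_values[OF that, of "{..<n}"] autocorr_nonneg[OF assms(3) that]
      by (intro mult_left_mono) auto
    then show ?thesis by (intro mult_right_mono) auto
  qed
  then show ?thesis
    by (simp add: dual_stab_expectation[OF assms(1,2)] Stab_def set_iid_noise_pmf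
          noise_stab_autocorr expectation_pmf_cube[OF set_iid_noise_pmf] sum_mono)
qed

lemma walsh_full:
  assumes "z \<in> cube n"
  shows "walsh {..<n} z = (-1) ^ hdist n z (ones n)"
proof -
  have "(-1) ^ hdist n z (ones n) = (\<Prod>i<n. (-1) ^ (if z i = -1 then 1 else 0) :: real)"
    by (simp add: hdist_ones[OF assms] power_sum)
  also have "\<dots> = walsh {..<n} z"
    using cube_values[OF assms] by (intro prod.cong) force+
  finally show ?thesis by simp
qed

text \<open>Odd noise moves a point to the other parity class, so a point and its image never lie in
  the support together and the autocorrelation vanishes. For even noise the sign is 1.\<close>

lemma dual_stab_eq_Stab:
  assumes \<beta>: "0 \<le> \<beta>" "\<beta> \<le> 1"
    and supp: "{x \<in> cube n. f x \<noteq> 0} \<subseteq> {x \<in> cube n. even (hdist n x (ones n))} \<or>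
      {x \<in> cube n. f x \<noteq> 0} \<subseteq> {x \<in> cube n. odd (hdist n x (ones n))}"
  shows "dual_stab n \<beta> f = Stab n \<beta> f"
proof -
  have "autocorr n f z * walsh {..<n} z = autocorr n f z" if z: "z \<in> cube n" for z
  proof (cases "walsh {..<n} z = 1")
    case False
    then have z1: "walsh {..<n} z = -1" using walsh_values[OF z, of "{..<n}"] by auto
    have "f x * f (cmult n x z) = 0" if x: "x \<in> cube n" for x
    proof (rule ccontr)
      assume "f x * f (cmult n x z) \<noteq> 0"
      then have "x \<in> {x \<in> cube n. f x \<noteq> 0}" "cmult n x z \<in> {x \<in> cube n. f x \<noteq> 0}"
        using x z by auto
      then have "even (hdist n x (ones n)) = even (hdist n (cmult n x z) (ones n))"
        using supp by blast
      then have "walsh {..<n} x = walsh {..<n} (cmult n x z)"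
        unfolding walsh_full[OF x] walsh_full[OF cmult_in_cube[OF x z]]
        by (simp add: minus_one_power_iff)
      then have "walsh {..<n} x = walsh {..<n} x * -1"
        unfolding walsh_cmult[OF subset_refl] z1 .
      then show False
        using walsh_values[OF x subset_refl] by linarith
    qed
    then have "(\<Sum>x\<in>cube n. f x * f (cmult n x z)) = 0" by (intro sum.neutral ballI)
    then have "autocorr n f z = 0" by (simp only: autocorr_def div_0)
    then show ?thesis by simp
  qed simp
  then show ?thesis
    unfolding dual_stab_expectation[OF \<beta>] Stab_def noise_stab_autocorr[OF set_iid_noise_pmf]
      expectation_pmf_cube[OF set_iid_noise_pmf]
    by (intro sum.cong refl) (simp only:)
qed

text \<open>A uniform error in the multiplier costs at most that error times the total Fourier
  weight, which is the second moment by Parseval.\<close>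

lemma noise_stab_near:
  assumes Q: "set_pmf Q \<subseteq> cube n"
    and near: "\<And>S. S \<subseteq> {..<n} \<Longrightarrow> \<bar>measure_pmf.expectation Q (walsh S) - t (card S)\<bar> \<le> e"
  shows "\<bar>noise_stab n Q f - (\<Sum>S\<in>Pow {..<n}. (fourier_coeff n f S)\<^sup>2 * t (card S))\<bar> \<le>
    e * measure_pmf.expectation (cube_pmf n) (\<lambda>x. (f x)\<^sup>2)"
proof -
  have "\<bar>noise_stab n Q f - (\<Sum>S\<in>Pow {..<n}. (fourier_coeff n f S)\<^sup>2 * t (card S))\<bar> =
      \<bar>\<Sum>S\<in>Pow {..<n}. (fourier_coeff n f S)\<^sup>2 *
        (measure_pmf.expectation Q (walsh S) - t (card S))\<bar>"
    by (simp add: noise_stab_fourier[OF Q] right_diff_distrib flip: sum_subtractf)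
  also have "\<dots> \<le> (\<Sum>S\<in>Pow {..<n}. (fourier_coeff n f S)\<^sup>2 * e)"
    by (rule order_trans[OF sum_abs], intro sum_mono)
       (auto simp: abs_mult intro!: mult_left_mono near)
  also have "\<dots> = e * measure_pmf.expectation (cube_pmf n) (\<lambda>x. (f x)\<^sup>2)"
    by (simp only: sum_distrib_left mult.commute flip: parseval)
  finally show ?thesis .
qed

section \<open>Fourier-weight stability\<close>

lemma top_fourier_weight:
  "(\<Sum>k = n - k\<^sub>0..n. fourier_weight n k f) =
     (\<Sum>S | S \<subseteq> {..<n} \<and> n - k\<^sub>0 \<le> card S. (fourier_coeff n f S)\<^sup>2)"
proof -
  have "(\<Sum>S | S \<subseteq> {..<n} \<and> n - k\<^sub>0 \<le> card S. (fourier_coeff n f S)\<^sup>2) =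
      (\<Sum>k = n - k\<^sub>0..n. \<Sum>S | S \<in> {S. S \<subseteq> {..<n} \<and> n - k\<^sub>0 \<le> card S} \<and> card S = k.
        (fourier_coeff n f S)\<^sup>2)"
    by (intro sum.group[symmetric]) (auto dest: card_mono[OF finite_lessThan])
  also have "\<dots> = (\<Sum>k = n - k\<^sub>0..n. fourier_weight n k f)"
    unfolding fourier_weight_def by (intro sum.cong) auto
  finally show ?thesis by simp
qed

text \<open>Degrees within \<open>k\<^sub>0\<close> of \<open>n\<close> have multiplier at most 1
  and form the top weight; the others have multiplier at most
  \<open>\<theta> ^ k\<^sub>0\<close>.\<close>

lemma dual_stab_le_top_weight:
  assumes "0 \<le> 1 - 2 * \<beta>" "1 - 2 * \<beta> \<le> \<theta>" "\<theta> \<le> 1"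
  shows "dual_stab n \<beta> f \<le> (\<Sum>k = n - k\<^sub>0..n. fourier_weight n k f) +
    \<theta> ^ k\<^sub>0 * measure_pmf.expectation (cube_pmf n) (\<lambda>x. (f x)\<^sup>2)"
proof -
  have "dual_stab n \<beta> f \<le> (\<Sum>S\<in>Pow {..<n}.
      (if n - k\<^sub>0 \<le> card S then (fourier_coeff n f S)\<^sup>2 else 0) + (fourier_coeff n f S)\<^sup>2 * \<theta> ^ k\<^sub>0)"
    unfolding dual_stab_def
  proof (intro sum_mono)
    fix S
    show "(fourier_coeff n f S)\<^sup>2 * (1 - 2 * \<beta>) ^ (n - card S) \<le>
        (if n - k\<^sub>0 \<le> card S then (fourier_coeff n f S)\<^sup>2 else 0) + (fourier_coeff n f S)\<^sup>2 * \<theta> ^ k\<^sub>0"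
    proof (cases "n - k\<^sub>0 \<le> card S")
      case True
      have "(fourier_coeff n f S)\<^sup>2 * (1 - 2 * \<beta>) ^ (n - card S) \<le> (fourier_coeff n f S)\<^sup>2 * 1"
        using assms by (intro mult_left_mono power_le_one) auto
      moreover have "0 \<le> (fourier_coeff n f S)\<^sup>2 * \<theta> ^ k\<^sub>0" using assms by simp
      ultimately show ?thesis using True by simp
    next
      case False
      have "(1 - 2 * \<beta>) ^ (n - card S) \<le> \<theta> ^ (n - card S)" using assms by (intro power_mono)
      also have "\<dots> \<le> \<theta> ^ k\<^sub>0" using assms False by (intro power_decreasing) auto
      finally show ?thesis using False by (auto intro: mult_left_mono)
    qed
  qed
  also have "\<dots> = (\<Sum>k = n - k\<^sub>0..n. fourier_weight n k f) +
      (\<Sum>S\<in>Pow {..<n}. (fourier_coeff n f S)\<^sup>2) * \<theta> ^ k\<^sub>0"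
    by (simp add: top_fourier_weight sum.distrib Pow_def flip: sum_distrib_right sum.inter_filter)
  also have "\<dots> = (\<Sum>k = n - k\<^sub>0..n. fourier_weight n k f) +
      \<theta> ^ k\<^sub>0 * measure_pmf.expectation (cube_pmf n) (\<lambda>x. (f x)\<^sup>2)"
    by (simp only: parseval mult.commute)
  finally show ?thesis .
qed

section \<open>Total influence\<close>

definition flip :: "nat \<Rightarrow> nat \<Rightarrow> nat \<Rightarrow> real" where
  "flip n i = (\<lambda>j\<in>{..<n}. if j = i then -1 else 1)"

lemma flip_in_cube [simp]: "flip n i \<in> cube n"
  by (auto simp: flip_def cube_def)

lemma walsh_flip: "S \<subseteq> {..<n} \<Longrightarrow> walsh S (flip n i) = (if i \<in> S then -1 else 1)"
proof -
  assume S: "S \<subseteq> {..<n}"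
  then have "walsh S (flip n i) = (\<Prod>j\<in>S. if j = i then -1 else 1)"
    by (intro prod.cong) (auto simp: flip_def)
  then show ?thesis using finite_subset[OF S] by (simp add: prod.delta)
qed

text \<open>Each difference is half the mean square change of \<open>f\<close> under flipping
  coordinate \<open>i\<close>, an influence. A flip of \<open>i\<close> negates exactly the
  characters with \<open>i \<in> S\<close>, so \<open>S\<close> is counted \<open>card S\<close>
  times.\<close>

lemma total_influence:
  "(\<Sum>i<n. autocorr n f (ones n) - autocorr n f (flip n i)) =
     2 * (\<Sum>S\<in>Pow {..<n}. (fourier_coeff n f S)\<^sup>2 * real (card S))"
proof -
  have "(\<Sum>i<n. autocorr n f (ones n) - autocorr n f (flip n i)) =
      (\<Sum>i<n. \<Sum>S\<in>Pow {..<n}. (fourier_coeff n f S)\<^sup>2 * (if i \<in> S then 2 else 0))"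
    by (intro sum.cong refl, simp only: autocorr_fourier ones_in_cube flip_in_cube
          flip: sum_subtractf)
       (intro sum.cong, auto simp: walsh_ones walsh_flip)
  also have "\<dots> = (\<Sum>S\<in>Pow {..<n}. (fourier_coeff n f S)\<^sup>2 * (\<Sum>i<n. if i \<in> S then 2 else 0))"
    by (subst sum.swap) (simp only: sum_distrib_left)
  also have "\<dots> = (\<Sum>S\<in>Pow {..<n}. (fourier_coeff n f S)\<^sup>2 * (2 * real (card S)))"
    by (intro sum.cong refl) (auto simp: Int_absorb1 simp flip: sum.inter_restrict)
  finally show ?thesis by (simp add: sum_distrib_left mult_ac)
qed

text \<open>The levels \<open>\<ge> n - k\<^sub>0\<close> carry weight at most \<open>1 / (n - k\<^sub>0)\<close> times the total influence.\<close>

lemma fourier_weight_stable_if_influence: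
  assumes \<eta>: "\<eta> \<longlonglongrightarrow> 0"
    and infl: "\<And>n. (\<Sum>i<n. autocorr n (f n) (ones n) - autocorr n (f n) (flip n i)) \<le> real n * \<eta> n"
  shows "fourier_weight_stable f"
  unfolding fourier_weight_stable_def
proof
  fix k\<^sub>0
  have nonneg: "0 \<le> (\<Sum>k = n - k\<^sub>0..n. fourier_weight n k (f n))" for n
    unfolding fourier_weight_def by (intro sum_nonneg) auto
  have le: "(\<Sum>k = n - k\<^sub>0..n. fourier_weight n k (f n)) \<le> \<eta> n" if n: "2 * k\<^sub>0 + 1 \<le> n" for n
  proof -
    let ?W = "\<Sum>k = n - k\<^sub>0..n. fourier_weight n k (f n)"
    have "real (n - k\<^sub>0) * ?W \<le> (\<Sum>S | S \<subseteq> {..<n} \<and> n - k\<^sub>0 \<le> card S.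
        (fourier_coeff n (f n) S)\<^sup>2 * real (card S))"
      unfolding top_fourier_weight sum_distrib_left
      by (intro sum_mono, subst mult.commute) (auto intro!: mult_left_mono)
    also have "\<dots> \<le> (\<Sum>S\<in>Pow {..<n}. (fourier_coeff n (f n) S)\<^sup>2 * real (card S))"
      by (intro sum_mono2) auto
    finally have "2 * (real (n - k\<^sub>0) * ?W) \<le> real n * \<eta> n"
      using infl[of n] total_influence[of n "f n"] by linarith
    \<comment> \<open>As \<open>n\<close> exceeds \<open>2 * k\<^sub>0\<close>, the factor 2 from
      the total influence compensates for replacing \<open>n\<close> by
      \<open>n - k\<^sub>0\<close>.\<close>
    moreover have "real n * ?W \<le> 2 * real (n - k\<^sub>0) * ?W"
      using n nonneg by (intro mult_right_mono) auto
    ultimately have "real n * ?W \<le> real n * \<eta> n" by linarith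
    then show ?thesis using n by simp
  qed
  show "(\<lambda>n. \<Sum>k = n - k\<^sub>0..n. fourier_weight n k (f n)) \<longlonglongrightarrow> 0"
    by (rule tendsto_sandwich[OF _ _ tendsto_const \<eta>])
       (use nonneg le in \<open>auto simp: eventually_sequentially\<close>)
qed

section \<open>Hamming subcubes\<close>

lemma card_subcube:
  assumes T: "T \<subseteq> {..<n}" and a: "a \<in> cube n"
  shows "real (card (subcube n T a)) = 2 ^ n / 2 ^ card T"
proof -
  have "real (card (subcube n T a)) =
      (\<Sum>x\<in>cube n. \<Prod>i<n. if i \<in> T \<longrightarrow> x i = a i then 1 else 0)"
  proof -
    have "(\<Prod>i<n. if i \<in> T \<longrightarrow> x i = a i then 1 else 0) =
        (if \<forall>i\<in>T. x i = a i then 1 else 0 :: real)" for x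
      using T by (auto simp: prod_zero_iff intro!: prod.neutral)
    moreover have "real (card (subcube n T a)) =
        (\<Sum>x\<in>cube n. if \<forall>i\<in>T. x i = a i then 1 else 0)"
      by (simp add: subcube_def flip: sum.inter_filter)
    ultimately show ?thesis by (simp only:)
  qed
  also have "\<dots> = (\<Prod>i<n. if i \<in> T then 1 else 2)"
    using cube_values[OF a] by (subst sum_cube_prod) (intro prod.cong, auto, force)
  also have "\<dots> = 2 ^ (n - card T)"
    using T by (subst prod.If_cases) (auto simp: Diff_eq[symmetric] card_Diff_subset
        finite_subset[OF T])
  also have "\<dots> = 2 ^ n / 2 ^ card T"
    using card_mono[OF finite_lessThan T] by (simp add: power_diff)
  finally show ?thesis .
qed

lemma sum_indicator_cube: "A \<subseteq> cube n \<Longrightarrow> (\<Sum>x\<in>cube n. indicat_real A x) = real (card A)"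
  by (simp add: indicator_def sum.If_cases Int_absorb1 Int_def[symmetric] Collect_mem_eq)

text \<open>Only the fixed coordinates have influence, each at most the density of the subcube. With
  \<open>t\<close> fixed coordinates the total is at most \<open>t / 2^t\<close>, hence at most 1
  for every \<open>t\<close>.\<close>

lemma fourier_weight_stable_subcube:
  assumes "\<And>n. T n \<subseteq> {..<n}" "\<And>n. a n \<in> cube n"
  shows "fourier_weight_stable (\<lambda>n. indicat_real (subcube n (T n) (a n)))"
proof (rule fourier_weight_stable_if_influence)
  show "(\<lambda>n. 1 / real n) \<longlonglongrightarrow> 0" by real_asymp
  fix n
  let ?A = "subcube n (T n) (a n)"
  let ?f = "indicat_real ?A"
  have "autocorr n ?f (ones n) - autocorr n ?f (flip n i) \<le>
      (if i \<in> T n then 1 / 2 ^ card (T n) else 0)" for i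
  proof (cases "i \<in> T n")
    case True
    have "autocorr n ?f (ones n) = (\<Sum>x\<in>cube n. indicat_real ?A x) / 2 ^ n"
      unfolding autocorr_def by (intro arg_cong2[where f = "(/)"] sum.cong) (auto simp: indicator_def)
    also have "\<dots> = 1 / 2 ^ card (T n)"
      using card_subcube[OF assms] by (subst sum_indicator_cube) (auto simp: subcube_def)
    finally show ?thesis
      using True autocorr_nonneg[of n ?f "flip n i"] by simp
  next
    case False
    have "?f (cmult n x (flip n i)) = ?f x" if "x \<in> cube n" for x
    proof -
      have "cmult n x (flip n i) j = x j" if "j \<in> T n" for j
        using that False assms(1)[of n] by (auto simp: flip_def)
      then show ?thesis using that by (auto simp: indicator_def subcube_def)
    qed
    then show ?thesis using False by (simp add: autocorr_def)
  qed
  then have "(\<Sum>i<n. autocorr n ?f (ones n) - autocorr n ?f (flip n i)) \<le>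
      (\<Sum>i<n. if i \<in> T n then 1 / 2 ^ card (T n) else 0)"
    by (intro sum_mono)
  also have "\<dots> = real (card (T n)) / 2 ^ card (T n)"
    using assms(1)[of n] by (simp add: Int_absorb1 flip: sum.inter_restrict)
  also have "\<dots> \<le> real n * (1 / real n)"
  proof (cases "n = 0")
    \<comment> \<open>In dimension 0 the value of \<open>1 / real n\<close> is 0, but
      \<open>T n\<close> is empty and the left-hand side vanishes too.\<close>
    case True
    then show ?thesis using assms(1)[of n] by simp
  next
    case False
    have "real (card (T n)) \<le> 2 ^ card (T n)"
      by (metis less_exp less_imp_le of_nat_le_iff of_nat_numeral of_nat_power)
    then show ?thesis using False by simp
  qed
  finally show "(\<Sum>i<n. autocorr n ?f (ones n) - autocorr n ?f (flip n i)) \<le> real n * (1 / real n)" .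
qed

section \<open>Central binomial coefficients and Hamming balls\<close>

lemma central_binomial_Suc: "((2 * Suc m) choose Suc m) = 2 * ((2 * m + 1) choose m)"
proof -
  have "Suc m * ((2 * Suc m) choose Suc m) = (2 * Suc m) * ((2 * m + 1) choose m)"
    using binomial_absorption[of m "2 * Suc m"] by simp
  then show ?thesis
    by (metis mult.assoc mult.commute mult_cancel1 nat.distinct(1))
qed

text \<open>The linear factor makes the induction close: the left-hand side grows by
  \<open>4 (2 m + 1) (2 m + 3) / (m + 1)^2\<close>, which is at most 16 because
  \<open>(2 m + 1) (2 m + 3) \<le> (2 m + 2)^2\<close>.\<close>

lemma central_binomial_upper_bound:
  "(real ((2 * m) choose m))\<^sup>2 * (2 * real m + 1) \<le> 16 ^ m"
proof (induction m)
  case (Suc m)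
  define c where "c = real ((2 * m) choose m)"
  have "Suc m * ((2 * m + 1) choose m) = (2 * m + 1) * ((2 * m) choose m)"
    using binomial_absorb_comp[of "2 * m + 1" m] by simp
  then have "real (Suc m) * real ((2 * m + 1) choose m) = real (2 * m + 1) * c"
    unfolding c_def by (metis of_nat_mult)
  then have 2: "real ((2 * Suc m) choose Suc m) = 2 * (2 * real m + 1) * c / real (Suc m)"
    unfolding central_binomial_Suc by (simp add: field_simps)
  have "(real ((2 * Suc m) choose Suc m))\<^sup>2 * (2 * real (Suc m) + 1) =
      c\<^sup>2 * (2 * real m + 1) * (4 * ((2 * real m + 1) * (2 * real m + 3)) / (real (Suc m))\<^sup>2)"
    unfolding 2 by (simp add: power_divide power_mult_distrib power2_eq_square algebra_simps)
  also have "\<dots> \<le> 16 ^ m * 16"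
  proof (intro mult_mono)
    show "c\<^sup>2 * (2 * real m + 1) \<le> 16 ^ m" using Suc unfolding c_def .
    have "4 * ((2 * real m + 1) * (2 * real m + 3)) \<le> 16 * (real (Suc m))\<^sup>2"
      by (simp add: power2_eq_square algebra_simps)
    then show "4 * ((2 * real m + 1) * (2 * real m + 3)) / (real (Suc m))\<^sup>2 \<le> 16"
      by (subst pos_divide_le_eq) auto
  qed auto
  finally show ?case by simp
qed simp

lemma binomial_div_power_two_le: "real (n choose k) / 2 ^ n \<le> 1 / sqrt (real n + 1)"
proof -
  have sq: "(real (n choose (n div 2)))\<^sup>2 * (real n + 1) \<le> 4 ^ n"
  proof (cases "even n")
    case True
    then obtain m where "n = 2 * m" by blast
    then show ?thesis using central_binomial_upper_bound[of m] by (simp add: power_mult)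
  next
    case False
    then obtain m where m: "n = 2 * m + 1" using oddE by blast
    \<comment> \<open>The middle coefficient of an odd row is half of the next central one, hence
      the 4 after squaring.\<close>
    have "4 * (real (n choose (n div 2)))\<^sup>2 * (real n + 2) \<le> 16 ^ Suc m"
      using central_binomial_upper_bound[of "Suc m"] unfolding central_binomial_Suc
      by (simp add: m power_mult_distrib algebra_simps)
    moreover have "(16::real) ^ Suc m = 4 * 4 ^ n" by (simp add: m power_mult)
    ultimately have "(real (n choose (n div 2)))\<^sup>2 * (real n + 2) \<le> 4 ^ n"
      by (simp add: mult.commute)
    then show ?thesis by (smt (verit) mult_left_mono zero_le_power2)
  qed
  have "(real (n choose k))\<^sup>2 * (real n + 1) \<le> (real (n choose (n div 2)))\<^sup>2 * (real n + 1)"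
    using binomial_maximum[of n k] by (intro mult_right_mono power_mono) auto
  also note sq
  also have "(4::real) ^ n = (2 ^ n)\<^sup>2" by (simp add: power2_eq_square flip: power_mult_distrib)
  finally have "sqrt ((real (n choose k))\<^sup>2 * (real n + 1)) \<le> sqrt ((2 ^ n)\<^sup>2)"
    by (rule real_sqrt_le_mono)
  then have "real (n choose k) * sqrt (real n + 1) \<le> 2 ^ n"
    by (simp add: real_sqrt_mult)
  then show ?thesis by (simp add: field_simps)
qed

text \<open>Multiplication by the centre is an involution of the cube that takes the centre to
  \<open>ones n\<close> and preserves distances.\<close>

lemma card_hsphere_le:
  assumes c: "c \<in> cube n"
  shows "card (hsphere n c r) \<le> n choose r"
proof -
  have "card (hsphere n c r) \<le> card (hsphere n (ones n) r)"
  proof (rule card_inj_on_le[of "\<lambda>x. cmult n x c"])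
    have inv: "cmult n (cmult n x c) c = x" if "x \<in> cube n" for x
    proof (rule cube_eqI[of _ n])
      fix i assume i: "i < n"
      then show "cmult n (cmult n x c) c i = x i" using cube_values[OF c i] by auto
    qed (use that c in auto)
    show "inj_on (\<lambda>x. cmult n x c) (hsphere n c r)"
      by (rule inj_on_inverseI[of _ "\<lambda>x. cmult n x c"]) (auto simp: hsphere_def inv)
    show "(\<lambda>x. cmult n x c) ` hsphere n c r \<subseteq> hsphere n (ones n) r"
    proof
      fix y assume "y \<in> (\<lambda>x. cmult n x c) ` hsphere n c r"
      then obtain x where x: "x \<in> cube n" "hdist n x c = r" and y: "y = cmult n x c"
        by (auto simp: hsphere_def)
      have "x i * c i \<noteq> 1 \<longleftrightarrow> x i \<noteq> c i" if "i < n" for i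
        using cube_values[OF c that] cube_values[OF x(1) that] by auto
      then have "{i \<in> {..<n}. cmult n x c i \<noteq> ones n i} = {i \<in> {..<n}. x i \<noteq> c i}"
        by (intro Collect_cong conj_cong) simp_all
      then show "y \<in> hsphere n (ones n) r"
        using x c y by (simp add: hsphere_def hdist_def)
    qed
  qed simp
  then show ?thesis by (simp add: card_hsphere_ones)
qed

lemma hdist_flip: "hdist n (cmult n x (flip n i)) c \<le> Suc (hdist n x c)"
proof -
  have "{j \<in> {..<n}. cmult n x (flip n i) j \<noteq> c j} \<subseteq> insert i {j \<in> {..<n}. x j \<noteq> c j}"
    by (auto simp: flip_def split: if_splits)
  then have "hdist n (cmult n x (flip n i)) c \<le> card (insert i {j \<in> {..<n}. x j \<noteq> c j})"
    unfolding hdist_def by (intro card_mono) auto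
  also have "\<dots> \<le> Suc (hdist n x c)"
    unfolding hdist_def by (rule card_insert_le_m1) auto
  finally show ?thesis .
qed

text \<open>A flip increases the distance by at most one, so only points of the boundary sphere can
  leave the ball. Every influence is bounded by the density of that sphere, of order
  \<open>1 / sqrt n\<close> for all centres and radii.\<close>

lemma fourier_weight_stable_hball:
  assumes c: "\<And>n. c n \<in> cube n"
  shows "fourier_weight_stable (\<lambda>n. indicat_real (hball n (c n) (\<rho> n)))"
proof (rule fourier_weight_stable_if_influence)
  show "(\<lambda>n. 1 / sqrt (real n + 1)) \<longlonglongrightarrow> 0" by real_asymp
  fix n
  let ?f = "indicat_real (hball n (c n) (\<rho> n))"
  let ?A = "hsphere n (c n) (\<rho> n)"
  have "autocorr n ?f (ones n) - autocorr n ?f (flip n i) \<le> 1 / sqrt (real n + 1)" for i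
  proof -
    have "autocorr n ?f (ones n) - autocorr n ?f (flip n i) =
        (\<Sum>x\<in>cube n. ?f x * ?f x - ?f x * ?f (cmult n x (flip n i))) / 2 ^ n"
      by (simp add: autocorr_def sum_subtractf diff_divide_distrib)
    also have "\<dots> \<le> (\<Sum>x\<in>cube n. indicat_real ?A x) / 2 ^ n"
    proof (intro divide_right_mono sum_mono)
      fix x assume x: "x \<in> cube n"
      show "?f x * ?f x - ?f x * ?f (cmult n x (flip n i)) \<le> indicat_real ?A x"
        using x hdist_flip[of n x i "c n"] by (auto simp: indicator_def hball_def hsphere_def)
    qed simp
    also have "\<dots> = real (card ?A) / 2 ^ n"
      by (subst sum_indicator_cube) (auto simp: hsphere_def)
    also have "\<dots> \<le> real (n choose \<rho> n) / 2 ^ n"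
      using card_hsphere_le[OF c, of n "\<rho> n"] by (intro divide_right_mono) auto
    also have "\<dots> \<le> 1 / sqrt (real n + 1)" by (rule binomial_div_power_two_le)
    finally show ?thesis .
  qed
  then have "(\<Sum>i<n. autocorr n ?f (ones n) - autocorr n ?f (flip n i)) \<le>
      (\<Sum>i<n. 1 / sqrt (real n + 1))"
    by (intro sum_mono)
  then show "(\<Sum>i<n. autocorr n ?f (ones n) - autocorr n ?f (flip n i)) \<le>
      real n * (1 / sqrt (real n + 1))"
    by simp
qed

section \<open>Uniform error terms\<close>

lemma admissible_radius:
  assumes "0 < \<delta>" "real r / real n \<in> {\<delta>..1/2 - \<delta>}"
  shows "\<delta> < 1/2" "r \<le> n" "0 \<le> real r / real n" "real r / real n \<le> 1/2"
    "0 \<le> 1 - 2 * (real r / real n)" "1 - 2 * (real r / real n) \<le> 1 - 2 * \<delta>"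
    "real r / real n \<le> 1"
proof -
  \<comment> \<open>For \<open>n = 0\<close> the quotient \<open>r / 0\<close> is 0, which lies
    below \<delta>.\<close>
  have n: "0 < n" using assms by (cases "n = 0") auto
  show 1: "\<delta> < 1/2" "0 \<le> real r / real n" "real r / real n \<le> 1/2"
    using assms unfolding atLeastAtMost_iff by linarith+
  show "0 \<le> 1 - 2 * (real r / real n)" "1 - 2 * (real r / real n) \<le> 1 - 2 * \<delta>"
    using assms unfolding atLeastAtMost_iff by linarith+
  show "real r / real n \<le> 1" using 1 by linarith
  then show "r \<le> n" using n by simp
qed

text \<open>Only finitely many radii are admissible for each \<open>n\<close>, so the worst
  deviation is a maximum and serves as the error sequence.\<close>

lemma uniform_error:
  assumes \<delta>: "0 < \<delta>"
    and V: "\<And>\<epsilon>. 0 < \<epsilon> \<Longrightarrow>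
      \<exists>N. \<forall>n\<ge>N. \<forall>r. real r / real n \<in> {\<delta>..1/2 - \<delta>} \<longrightarrow> \<bar>V n r\<bar> \<le> (\<epsilon> :: real)"
  obtains e where "e \<longlonglongrightarrow> 0"
    and "\<And>n r. real r / real n \<in> {\<delta>..1/2 - \<delta>} \<Longrightarrow> \<bar>V n r\<bar> \<le> e n"
proof
  define R where "R n = {r. real r / real n \<in> {\<delta>..1/2 - \<delta>}}" for n
  have fin: "finite (R n)" for n
    using admissible_radius(2)[OF \<delta>] by (intro finite_subset[of "R n" "{..n}"]) (auto simp: R_def)
  \<comment> \<open>Inserting 0 covers dimensions without admissible radii and keeps
    \<open>e\<close> nonnegative.\<close>
  define e where "e n = Max (insert 0 ((\<lambda>r. \<bar>V n r\<bar>) ` R n))" for n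
  show "\<bar>V n r\<bar> \<le> e n" if "real r / real n \<in> {\<delta>..1/2 - \<delta>}" for n r
    unfolding e_def using that fin by (intro Max_ge) (auto simp: R_def)
  show "e \<longlonglongrightarrow> 0"
  proof (rule LIMSEQ_I)
    fix \<epsilon> :: real assume \<epsilon>: "0 < \<epsilon>"
    then obtain N where N: "\<And>n r. n \<ge> N \<Longrightarrow> real r / real n \<in> {\<delta>..1/2 - \<delta>} \<Longrightarrow> \<bar>V n r\<bar> \<le> \<epsilon> / 2"
      using V[of "\<epsilon> / 2"] by auto
    have "norm (e n - 0) < \<epsilon>" if "n \<ge> N" for n
    proof -
      have "e n \<le> \<epsilon> / 2"
        unfolding e_def using fin N[OF that] \<epsilon> by (intro Max.boundedI) (auto simp: R_def)
      moreover have "0 \<le> e n" unfolding e_def using fin by (intro Max_ge) auto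
      ultimately show ?thesis using \<epsilon> by simp
    qed
    then show "\<exists>N. \<forall>n\<ge>N. norm (e n - 0) < \<epsilon>" by blast
  qed
qed

text \<open>The multiplier limit, taken with precision \<open>\<epsilon> / M\<close>, is summed
  against Fourier weights of total mass at most \<open>M\<close>.\<close>

lemma SStab_asymptotics:
  assumes \<delta>: "0 < \<delta>" and M: "0 < M"
    "\<forall>\<^sub>F n in sequentially. measure_pmf.expectation (cube_pmf n) (\<lambda>x. (f n x)\<^sup>2) \<le> M"
  obtains e where "e \<longlonglongrightarrow> 0"
    and "\<And>n r. real r / real n \<in> {\<delta>..1/2 - \<delta>} \<Longrightarrow>
      \<bar>SStab n r (f n) - (Stab n (r / n) (f n) + (-1) ^ r * dual_stab n (r / n) (f n))\<bar> \<le> e n"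
proof (rule uniform_error[OF \<delta>, of
      "\<lambda>n r. SStab n r (f n) - (Stab n (r / n) (f n) + (-1) ^ r * dual_stab n (r / n) (f n))"])
  fix \<epsilon> :: real assume \<epsilon>: "0 < \<epsilon>"
  show "\<exists>N. \<forall>n\<ge>N. \<forall>r. real r / real n \<in> {\<delta>..1/2 - \<delta>} \<longrightarrow>
    \<bar>SStab n r (f n) - (Stab n (r / n) (f n) + (-1) ^ r * dual_stab n (r / n) (f n))\<bar> \<le> \<epsilon>"
  proof (cases "\<delta> < 1/2")
    case True
    obtain N1 where N1: "\<And>n r k. n \<ge> N1 \<Longrightarrow> real r / real n \<in> {\<delta>..1/2 - \<delta>} \<Longrightarrow> k \<le> n \<Longrightarrow>
        \<bar>kraw n k r / real (n choose r) - ((1 - 2 * (real r / real n)) ^ k +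
          (-1) ^ r * (1 - 2 * (real r / real n)) ^ (n - k))\<bar> \<le> \<epsilon> / M"
      using normalized_kraw_uniform_limit[OF \<delta> True, of "\<epsilon> / M"] \<epsilon> M(1) by auto
    obtain N2 where N2: "\<And>n. n \<ge> N2 \<Longrightarrow>
        measure_pmf.expectation (cube_pmf n) (\<lambda>x. (f n x)\<^sup>2) \<le> M"
      using M(2) unfolding eventually_sequentially by blast
    show ?thesis
    proof (intro exI[of _ "max N1 N2"] allI impI)
      fix n r :: nat assume n: "max N1 N2 \<le> n" and r: "real r / real n \<in> {\<delta>..1/2 - \<delta>}"
      note adm = admissible_radius[OF \<delta> r]
      define t where "t k = (1 - 2 * (real r / real n)) ^ k +
        (-1) ^ r * (1 - 2 * (real r / real n)) ^ (n - k)" for k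
      have "\<bar>SStab n r (f n) - (\<Sum>S\<in>Pow {..<n}. (fourier_coeff n (f n) S)\<^sup>2 * t (card S))\<bar> \<le>
          \<epsilon> / M * measure_pmf.expectation (cube_pmf n) (\<lambda>x. (f n x)\<^sup>2)"
        unfolding SStab_def
      proof (rule noise_stab_near)
        show "set_pmf (pmf_of_set (hsphere n (ones n) r)) \<subseteq> cube n"
          using hsphere_ones_not_empty[OF adm(2)] hsphere_subset_cube by simp
        fix S assume S: "S \<subseteq> {..<n}"
        have "card S \<le> n" using card_mono[OF finite_lessThan S] by simp
        then show "\<bar>measure_pmf.expectation (pmf_of_set (hsphere n (ones n) r)) (walsh S) -
            t (card S)\<bar> \<le> \<epsilon> / M"
          using N1[OF _ r] n unfolding t_def expectation_sphere_walsh[OF S adm(2)] by simp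
      qed
      also have "\<dots> \<le> \<epsilon> / M * M"
        using N2[of n] n \<epsilon> M(1) by (intro mult_left_mono) auto
      also have "\<dots> = \<epsilon>" using M(1) by simp
      also have "(\<Sum>S\<in>Pow {..<n}. (fourier_coeff n (f n) S)\<^sup>2 * t (card S)) =
          Stab n (r / n) (f n) + (-1) ^ r * dual_stab n (r / n) (f n)"
        unfolding t_def dual_stab_def sum_distrib_left Stab_fourier[OF adm(3,7)]
        by (simp only: distrib_left sum.distrib mult_ac)
      finally show "\<bar>SStab n r (f n) -
          (Stab n (r / n) (f n) + (-1) ^ r * dual_stab n (r / n) (f n))\<bar> \<le> \<epsilon>" .
    qed
  next
    \<comment> \<open>For \<delta> \<ge> 1/2 no radius is admissible.\<close>
    case False
    then show ?thesis using admissible_radius(1)[OF \<delta>] by blast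
  qed
qed (use that in blast)

lemma BStab_asymptotics:
  assumes \<delta>: "0 < \<delta>" and M: "0 < M"
    "\<forall>\<^sub>F n in sequentially. measure_pmf.expectation (cube_pmf n) (\<lambda>x. (f n x)\<^sup>2) \<le> M"
  obtains e where "e \<longlonglongrightarrow> 0"
    and "\<And>n r. real r / real n \<in> {\<delta>..1/2 - \<delta>} \<Longrightarrow>
      \<bar>BStab n r (f n) - (Stab n (r / n) (f n) +
        (-1) ^ r * (1 - 2 * (r / n)) * dual_stab n (r / n) (f n))\<bar> \<le> e n"
proof (rule uniform_error[OF \<delta>, of
      "\<lambda>n r. BStab n r (f n) - (Stab n (r / n) (f n) +
        (-1) ^ r * (1 - 2 * (r / n)) * dual_stab n (r / n) (f n))"])
  fix \<epsilon> :: real assume \<epsilon>: "0 < \<epsilon>"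
  show "\<exists>N. \<forall>n\<ge>N. \<forall>r. real r / real n \<in> {\<delta>..1/2 - \<delta>} \<longrightarrow>
    \<bar>BStab n r (f n) - (Stab n (r / n) (f n) +
      (-1) ^ r * (1 - 2 * (r / n)) * dual_stab n (r / n) (f n))\<bar> \<le> \<epsilon>"
  proof (cases "\<delta> < 1/2")
    case True
    obtain N1 where N1: "\<And>n r k. n \<ge> N1 \<Longrightarrow> real r / real n \<in> {\<delta>..1/2 - \<delta>} \<Longrightarrow>
        1 \<le> k \<Longrightarrow> k \<le> n \<Longrightarrow>
        \<bar>(kraw n k r + kraw n (k - 1) r) / (2 * (\<Sum>j\<le>r. real (n choose j))) -
          ((1 - 2 * (real r / real n)) ^ k + (-1) ^ r * (1 - 2 * (real r / real n)) *
            (1 - 2 * (real r / real n)) ^ (n - k))\<bar> \<le> \<epsilon> / M"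
      using ball_kraw_uniform_limit[OF \<delta> True, of "\<epsilon> / M"] \<epsilon> M(1) by auto
    obtain N2 where N2: "\<And>n. n \<ge> N2 \<Longrightarrow>
        measure_pmf.expectation (cube_pmf n) (\<lambda>x. (f n x)\<^sup>2) \<le> M"
      using M(2) unfolding eventually_sequentially by blast
    \<comment> \<open>Degree 0 lies outside the ball estimate: the true multiplier is 1, while the
      formula also adds a reflected power. That power is exponentially small in \<open>n\<close>,
      and \<open>N3\<close> controls it.\<close>
    obtain N3 where N3: "(1 - 2 * \<delta>) ^ N3 < \<epsilon> / M"
      using real_arch_pow_inv[of "\<epsilon> / M" "1 - 2 * \<delta>"] \<epsilon> M(1) \<delta> by auto
    show ?thesis
    proof (intro exI[of _ "max N1 (max N2 N3)"] allI impI)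
      fix n r :: nat
      assume n: "max N1 (max N2 N3) \<le> n" and r: "real r / real n \<in> {\<delta>..1/2 - \<delta>}"
      note adm = admissible_radius[OF \<delta> r]
      define t where "t k = (1 - 2 * (real r / real n)) ^ k +
        (-1) ^ r * (1 - 2 * (real r / real n)) * (1 - 2 * (real r / real n)) ^ (n - k)" for k
      have "\<bar>BStab n r (f n) - (\<Sum>S\<in>Pow {..<n}. (fourier_coeff n (f n) S)\<^sup>2 * t (card S))\<bar> \<le>
          \<epsilon> / M * measure_pmf.expectation (cube_pmf n) (\<lambda>x. (f n x)\<^sup>2)"
        unfolding BStab_def
      proof (rule noise_stab_near)
        show "set_pmf (pmf_of_set (hball n (ones n) r)) \<subseteq> cube n"
          using hball_ones_not_empty hball_subset_cube by simp
        fix S assume S: "S \<subseteq> {..<n}"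
        show "\<bar>measure_pmf.expectation (pmf_of_set (hball n (ones n) r)) (walsh S) -
            t (card S)\<bar> \<le> \<epsilon> / M"
        proof (cases "S = {}")
          case True
          define \<rho> where "\<rho> = 1 - 2 * (real r / real n)"
          have \<rho>: "0 \<le> \<rho>" "\<rho> \<le> 1" "\<rho> \<le> 1 - 2 * \<delta>"
            using adm \<delta> unfolding \<rho>_def by linarith+
          have "\<bar>(-1) ^ r * \<rho> * \<rho> ^ n\<bar> = \<rho> * \<rho> ^ n"
            using \<rho> by (simp add: abs_mult power_abs)
          also have "\<dots> \<le> 1 * \<rho> ^ n" using \<rho> by (intro mult_right_mono) auto
          also have "\<dots> \<le> (1 - 2 * \<delta>) ^ n" using \<rho> by (simp add: power_mono)
          also have "\<dots> \<le> (1 - 2 * \<delta>) ^ N3" using n \<rho> \<delta> by (intro power_decreasing) auto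
          also have "\<dots> \<le> \<epsilon> / M" using N3 by simp
          finally show ?thesis by (simp add: True t_def \<rho>_def)
        next
          case False
          have "card S \<le> n" using card_mono[OF finite_lessThan S] by simp
          moreover have "1 \<le> card S"
            using False finite_subset[OF S] by (simp add: Suc_le_eq card_gt_0_iff)
          ultimately show ?thesis
            using N1[OF _ r] n unfolding t_def expectation_ball_walsh[OF S False] by simp
        qed
      qed
      also have "\<dots> \<le> \<epsilon> / M * M"
        using N2[of n] n \<epsilon> M(1) by (intro mult_left_mono) auto
      also have "\<dots> = \<epsilon>" using M(1) by simp
      also have "(\<Sum>S\<in>Pow {..<n}. (fourier_coeff n (f n) S)\<^sup>2 * t (card S)) =
          Stab n (r / n) (f n) + (-1) ^ r * (1 - 2 * (r / n)) * dual_stab n (r / n) (f n)"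
        unfolding t_def dual_stab_def sum_distrib_left Stab_fourier[OF adm(3,7)]
        by (simp only: distrib_left sum.distrib mult_ac)
      finally show "\<bar>BStab n r (f n) - (Stab n (r / n) (f n) +
          (-1) ^ r * (1 - 2 * (r / n)) * dual_stab n (r / n) (f n))\<bar> \<le> \<epsilon>" .
    qed
  next
    case False
    then show ?thesis using admissible_radius(1)[OF \<delta>] by blast
  qed
qed (use that in blast)

text \<open>The cut-off \<open>k\<^sub>0\<close> depends on \<delta>, \<epsilon> and
  \<open>M\<close> only and leaves at most \<epsilon>/2 to the lower degrees; stability then applies
  to the top weight for this fixed \<open>k\<^sub>0\<close>.\<close>

lemma dual_stab_vanishes:
  assumes \<delta>: "0 < \<delta>" and M: "0 < M"
    "\<forall>\<^sub>F n in sequentially. measure_pmf.expectation (cube_pmf n) (\<lambda>x. (f n x)\<^sup>2) \<le> M"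
    and stable: "fourier_weight_stable f"
  obtains e where "e \<longlonglongrightarrow> 0"
    and "\<And>n r. real r / real n \<in> {\<delta>..1/2 - \<delta>} \<Longrightarrow> \<bar>dual_stab n (r / n) (f n)\<bar> \<le> e n"
proof (rule uniform_error[OF \<delta>, of "\<lambda>n r. dual_stab n (r / n) (f n)"])
  fix \<epsilon> :: real assume \<epsilon>: "0 < \<epsilon>"
  show "\<exists>N. \<forall>n\<ge>N. \<forall>r. real r / real n \<in> {\<delta>..1/2 - \<delta>} \<longrightarrow>
    \<bar>dual_stab n (r / n) (f n)\<bar> \<le> \<epsilon>"
  proof (cases "\<delta> < 1/2")
    case True
    obtain k\<^sub>0 where k\<^sub>0: "(1 - 2 * \<delta>) ^ k\<^sub>0 < \<epsilon> / 2 / M"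
      using real_arch_pow_inv[of "\<epsilon> / 2 / M" "1 - 2 * \<delta>"] \<epsilon> M(1) \<delta> by auto
    have "(\<lambda>n. \<Sum>k = n - k\<^sub>0..n. fourier_weight n k (f n)) \<longlonglongrightarrow> 0"
      using stable by (simp add: fourier_weight_stable_def)
    then have "\<forall>\<^sub>F n in sequentially. (\<Sum>k = n - k\<^sub>0..n. fourier_weight n k (f n)) < \<epsilon> / 2"
      by (rule order_tendstoD) (use \<epsilon> in simp)
    from eventually_conj[OF this M(2)] obtain N where
      N: "\<And>n. n \<ge> N \<Longrightarrow> (\<Sum>k = n - k\<^sub>0..n. fourier_weight n k (f n)) < \<epsilon> / 2"
        "\<And>n. n \<ge> N \<Longrightarrow> measure_pmf.expectation (cube_pmf n) (\<lambda>x. (f n x)\<^sup>2) \<le> M"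
      unfolding eventually_sequentially by blast
    show ?thesis
    proof (intro exI[of _ N] allI impI)
      fix n r :: nat assume n: "N \<le> n" and r: "real r / real n \<in> {\<delta>..1/2 - \<delta>}"
      note adm = admissible_radius[OF \<delta> r]
      have "dual_stab n (r / n) (f n) \<le> (\<Sum>k = n - k\<^sub>0..n. fourier_weight n k (f n)) +
          (1 - 2 * \<delta>) ^ k\<^sub>0 * measure_pmf.expectation (cube_pmf n) (\<lambda>x. (f n x)\<^sup>2)"
        using adm \<delta> by (intro dual_stab_le_top_weight) auto
      moreover have "(1 - 2 * \<delta>) ^ k\<^sub>0 * measure_pmf.expectation (cube_pmf n) (\<lambda>x. (f n x)\<^sup>2) \<le>
          \<epsilon> / 2 / M * M"
        using k\<^sub>0 N(2)[OF n] \<epsilon> M(1) by (intro mult_mono) auto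
      moreover have "\<epsilon> / 2 / M * M = \<epsilon> / 2" using M(1) by simp
      moreover have "0 \<le> dual_stab n (r / n) (f n)"
        using adm(4) by (rule dual_stab_nonneg)
      ultimately show "\<bar>dual_stab n (r / n) (f n)\<bar> \<le> \<epsilon>"
        using N(1)[OF n] by linarith
    qed
  next
    case False
    then show ?thesis using admissible_radius(1)[OF \<delta>] by blast
  qed
qed (use that in blast)

lemma with_o1I:
  assumes "e \<longlonglongrightarrow> 0" "\<And>n r. real r / real n \<in> {\<delta>..1/2 - \<delta>} \<Longrightarrow> P n r (e n)"
  shows "with_o1 \<delta> P"
  unfolding with_o1_def using assms by blast

lemma SStab_nonneg:
  assumes "\<And>x. x \<in> cube n \<Longrightarrow> 0 \<le> f x" "r \<le> n"
  shows "0 \<le> SStab n r f"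
proof -
  have sub: "set_pmf (pmf_of_set (hsphere n (ones n) r)) \<subseteq> cube n"
    using hsphere_ones_not_empty[OF assms(2)] hsphere_subset_cube by simp
  show ?thesis
    unfolding SStab_def noise_stab_autocorr[OF sub] expectation_pmf_cube[OF sub]
    using autocorr_nonneg[OF assms(1)] by (intro sum_nonneg mult_nonneg_nonneg) auto
qed

lemma bounded_if_limsup_finite:
  assumes "limsup (\<lambda>n. ereal (X n)) < \<infinity>"
  obtains M where "0 < M" "\<forall>\<^sub>F n in sequentially. X n \<le> M"
proof -
  obtain m :: nat where "limsup (\<lambda>n. ereal (X n)) < ereal (real m)"
    using assms less_PInf_Ex_of_nat by (metis less_irrefl)
  then have "\<forall>\<^sub>F n in sequentially. ereal (X n) < ereal (real m)"
    by (rule Limsup_lessD)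
  then have "\<forall>\<^sub>F n in sequentially. X n \<le> real m + 1"
    by (rule eventually_mono) simp
  then show ?thesis by (intro that[of "real m + 1"]) auto
qed

theorem theorem18:
  fixes f :: "nat \<Rightarrow> (nat \<Rightarrow> real) \<Rightarrow> real" and \<delta> :: real
  assumes nonneg: "\<And>n x. x \<in> cube n \<Longrightarrow> 0 \<le> f n x"
    and bounded_L2:
      "limsup (\<lambda>n. ereal (measure_pmf.expectation (cube_pmf n) (\<lambda>x. (f n x)\<^sup>2))) < \<infinity>"
    and delta: "\<delta> > 0"
  shows
    "(with_o1 \<delta> (\<lambda>n r \<epsilon>. even r \<longrightarrow> Stab n (r / n) (f n) + \<epsilon> \<le> SStab n r (f n)) \<and>
      with_o1 \<delta> (\<lambda>n r \<epsilon>. even r \<longrightarrow> SStab n r (f n) \<le> 2 * Stab n (r / n) (f n) + \<epsilon>) \<and>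
      with_o1 \<delta> (\<lambda>n r \<epsilon>. even r \<longrightarrow> Stab n (r / n) (f n) + \<epsilon> \<le> BStab n r (f n)) \<and>
      with_o1 \<delta> (\<lambda>n r \<epsilon>. even r \<longrightarrow>
        BStab n r (f n) \<le> 2 * (1 - r / n) * Stab n (r / n) (f n) + \<epsilon>) \<and>
      (\<forall>n r. real r / real n \<in> {\<delta>..1/2 - \<delta>} \<longrightarrow> odd r \<longrightarrow> 0 \<le> SStab n r (f n)) \<and>
      with_o1 \<delta> (\<lambda>n r \<epsilon>. odd r \<longrightarrow> SStab n r (f n) \<le> Stab n (r / n) (f n) + \<epsilon>) \<and>
      with_o1 \<delta> (\<lambda>n r \<epsilon>. odd r \<longrightarrow>
        2 * (r / n) * Stab n (r / n) (f n) + \<epsilon> \<le> BStab n r (f n)) \<and>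
      with_o1 \<delta> (\<lambda>n r \<epsilon>. odd r \<longrightarrow> BStab n r (f n) \<le> Stab n (r / n) (f n) + \<epsilon>))
     \<and>
     ((\<forall>n. {x \<in> cube n. f n x \<noteq> 0} \<subseteq> {x \<in> cube n. even (hdist n x (ones n))} \<or>
           {x \<in> cube n. f n x \<noteq> 0} \<subseteq> {x \<in> cube n. odd (hdist n x (ones n))}) \<longrightarrow>
      with_o1 \<delta> (\<lambda>n r \<epsilon>. even r \<longrightarrow> \<bar>SStab n r (f n) - 2 * Stab n (r / n) (f n)\<bar> \<le> \<epsilon>) \<and>
      with_o1 \<delta> (\<lambda>n r \<epsilon>. even r \<longrightarrow>
        \<bar>BStab n r (f n) - 2 * (1 - r / n) * Stab n (r / n) (f n)\<bar> \<le> \<epsilon>) \<and>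
      with_o1 \<delta> (\<lambda>n r \<epsilon>. odd r \<longrightarrow> \<bar>SStab n r (f n) - 0\<bar> \<le> \<epsilon>) \<and>
      with_o1 \<delta> (\<lambda>n r \<epsilon>. odd r \<longrightarrow>
        \<bar>BStab n r (f n) - 2 * (r / n) * Stab n (r / n) (f n)\<bar> \<le> \<epsilon>))
     \<and>
     (fourier_weight_stable f \<longrightarrow>
      with_o1 \<delta> (\<lambda>n r \<epsilon>. even r \<longrightarrow> \<bar>SStab n r (f n) - Stab n (r / n) (f n)\<bar> \<le> \<epsilon>) \<and>
      with_o1 \<delta> (\<lambda>n r \<epsilon>. even r \<longrightarrow> \<bar>BStab n r (f n) - Stab n (r / n) (f n)\<bar> \<le> \<epsilon>) \<and>
      with_o1 \<delta> (\<lambda>n r \<epsilon>. odd r \<longrightarrow> \<bar>SStab n r (f n) - Stab n (r / n) (f n)\<bar> \<le> \<epsilon>) \<and>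
      with_o1 \<delta> (\<lambda>n r \<epsilon>. odd r \<longrightarrow> \<bar>BStab n r (f n) - Stab n (r / n) (f n)\<bar> \<le> \<epsilon>))
     \<and>
     ((\<forall>T a. (\<forall>n. T n \<subseteq> {..<n} \<and> a n \<in> cube n) \<longrightarrow>
         fourier_weight_stable (\<lambda>n. indicat_real (subcube n (T n) (a n)))) \<and>
      (\<forall>c \<rho>. (\<forall>n. c n \<in> cube n) \<longrightarrow>
         fourier_weight_stable (\<lambda>n. indicat_real (hball n (c n) (\<rho> n)))))"
proof -
  obtain M where M: "0 < M"
      "\<forall>\<^sub>F n in sequentially. measure_pmf.expectation (cube_pmf n) (\<lambda>x. (f n x)\<^sup>2) \<le> M"
    using bounded_if_limsup_finite[OF bounded_L2] by blast
  obtain eS where eS: "eS \<longlonglongrightarrow> 0"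
    and S: "\<And>n r. real r / real n \<in> {\<delta>..1/2 - \<delta>} \<Longrightarrow>
      \<bar>SStab n r (f n) - (Stab n (r / n) (f n) + (-1) ^ r * dual_stab n (r / n) (f n))\<bar> \<le> eS n"
    using SStab_asymptotics[OF delta M] by blast
  obtain eB where eB: "eB \<longlonglongrightarrow> 0"
    and B: "\<And>n r. real r / real n \<in> {\<delta>..1/2 - \<delta>} \<Longrightarrow>
      \<bar>BStab n r (f n) - (Stab n (r / n) (f n) +
        (-1) ^ r * (1 - 2 * (r / n)) * dual_stab n (r / n) (f n))\<bar> \<le> eB n"
    using BStab_asymptotics[OF delta M] by blast
  have S_even: "\<bar>SStab n r (f n) - (Stab n (r / n) (f n) + dual_stab n (r / n) (f n))\<bar> \<le> eS n"
    if "real r / real n \<in> {\<delta>..1/2 - \<delta>}" "even r" for n r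
    using S[OF that(1)] that(2) by simp
  have S_odd: "\<bar>SStab n r (f n) - (Stab n (r / n) (f n) - dual_stab n (r / n) (f n))\<bar> \<le> eS n"
    if "real r / real n \<in> {\<delta>..1/2 - \<delta>}" "odd r" for n r
    using S[OF that(1)] that(2) by simp
  \<comment> \<open>With these two products every remaining inequality is linear in the stabilities,
    \<open>dual_stab\<close>, \<open>P\<close> and \<open>Q\<close>.\<close>
  define P where "P n r = (1 - 2 * (r / n)) * dual_stab n (r / n) (f n)" for n r :: nat
  define Q where "Q n r = (1 - 2 * (r / n)) * Stab n (r / n) (f n)" for n r :: nat
  have B_even: "\<bar>BStab n r (f n) - (Stab n (r / n) (f n) + P n r)\<bar> \<le> eB n"
    if "real r / real n \<in> {\<delta>..1/2 - \<delta>}" "even r" for n r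
    using B[OF that(1)] that(2) by (simp add: P_def)
  have B_odd: "\<bar>BStab n r (f n) - (Stab n (r / n) (f n) - P n r)\<bar> \<le> eB n"
    if "real r / real n \<in> {\<delta>..1/2 - \<delta>}" "odd r" for n r
  proof -
    have "(-1) ^ r = (-1 :: real)" using that(2) by simp
    then have "(-1) ^ r * (1 - 2 * (real r / real n)) * dual_stab n (r / n) (f n) = - P n r"
      by (simp only: P_def mult_minus_left mult_1_left)
    then show ?thesis using B[OF that(1)] by (simp only: add_uminus_conv_diff)
  qed
  have D: "0 \<le> dual_stab n (r / n) (f n)" "dual_stab n (r / n) (f n) \<le> Stab n (r / n) (f n)"
      "0 \<le> P n r" "P n r \<le> Q n r" "P n r \<le> dual_stab n (r / n) (f n)"
    if r: "real r / real n \<in> {\<delta>..1/2 - \<delta>}" for n r :: nat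
  proof -
    note adm = admissible_radius[OF delta r]
    show 1: "0 \<le> dual_stab n (r / n) (f n)"
      using adm(4) by (rule dual_stab_nonneg)
    show 2: "dual_stab n (r / n) (f n) \<le> Stab n (r / n) (f n)"
      using adm(3,7) nonneg by (rule dual_stab_le_Stab)
    show "0 \<le> P n r"
      unfolding P_def using adm(5) 1 by (rule mult_nonneg_nonneg)
    show "P n r \<le> Q n r"
      unfolding P_def Q_def using 2 adm(5) by (rule mult_left_mono)
    show "P n r \<le> dual_stab n (r / n) (f n)"
      unfolding P_def using 1 adm(5) _ by (rule mult_left_le_one_le) (use adm(3) in simp)
  qed
  \<comment> \<open>With \<rho> = 1 - 2\<beta>, the constants \<open>2 (1 - \<beta>)\<close> and
    \<open>2 \<beta>\<close> are \<open>1 + \<rho>\<close> and \<open>1 - \<rho>\<close>.\<close>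
  have twice: "2 * (1 - r / n) * Stab n (r / n) (f n) = Stab n (r / n) (f n) + Q n r"
      "2 * (r / n) * Stab n (r / n) (f n) = Stab n (r / n) (f n) - Q n r" for n r :: nat
    by (simp_all add: Q_def algebra_simps)
  \<comment> \<open>Lower bounds carry the error on the smaller side, hence with a minus
    sign.\<close>
  have eS': "(\<lambda>n. - eS n) \<longlonglongrightarrow> 0" and eB': "(\<lambda>n. - eB n) \<longlonglongrightarrow> 0"
    using tendsto_minus[OF eS] tendsto_minus[OF eB] by simp_all
  show ?thesis
    (is "(?E1 \<and> ?E2 \<and> ?E3 \<and> ?E4 \<and> ?O1 \<and> ?O2 \<and> ?O3 \<and> ?O4) \<and> (?parity \<longrightarrow> ?tight) \<and>
      (?stable \<longrightarrow> ?R) \<and> ?examples")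
  proof (intro conjI)
    show ?E1
      by (rule with_o1I[OF eS'], rule impI, frule (1) S_even, frule D(1), linarith)
    show ?E2
      by (rule with_o1I[OF eS], rule impI, frule (1) S_even, frule D(2), linarith)
    show ?E3
      by (rule with_o1I[OF eB'], rule impI, frule (1) B_even, frule D(3), linarith)
    show ?E4
      unfolding twice by (rule with_o1I[OF eB], rule impI, frule (1) B_even, frule D(4), linarith)
    show ?O1
      using SStab_nonneg nonneg admissible_radius(2)[OF delta] by blast
    show ?O2
      by (rule with_o1I[OF eS], rule impI, frule (1) S_odd, frule D(1), linarith)
    show ?O3
      unfolding twice by (rule with_o1I[OF eB'], rule impI, frule (1) B_odd, frule D(4), linarith)
    show ?O4
      by (rule with_o1I[OF eB], rule impI, frule (1) B_odd, frule D(3), linarith)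
    show "?parity \<longrightarrow> ?tight"
    proof
      assume parity: ?parity
      \<comment> \<open>With constant parity of the support, the estimates of
        \<open>dual_stab\<close> and \<open>P\<close> from above become equalities.\<close>
      have eq: "dual_stab n (r / n) (f n) = Stab n (r / n) (f n)"
        if "real r / real n \<in> {\<delta>..1/2 - \<delta>}" for n r :: nat
        using admissible_radius(3,7)[OF delta that] parity[rule_format] by (rule dual_stab_eq_Stab)
      have PQ: "P n r = Q n r" if "real r / real n \<in> {\<delta>..1/2 - \<delta>}" for n r :: nat
        by (simp only: P_def Q_def eq[OF that])
      show ?tight
      proof (intro conjI)
        show "with_o1 \<delta> (\<lambda>n r \<epsilon>. even r \<longrightarrow> \<bar>SStab n r (f n) - 2 * Stab n (r / n) (f n)\<bar> \<le> \<epsilon>)"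
          by (rule with_o1I[OF eS], rule impI, frule (1) S_even, frule eq, simp)
        show "with_o1 \<delta> (\<lambda>n r \<epsilon>. even r \<longrightarrow>
            \<bar>BStab n r (f n) - 2 * (1 - r / n) * Stab n (r / n) (f n)\<bar> \<le> \<epsilon>)"
          unfolding twice by (rule with_o1I[OF eB], rule impI, frule (1) B_even, frule PQ, simp)
        show "with_o1 \<delta> (\<lambda>n r \<epsilon>. odd r \<longrightarrow> \<bar>SStab n r (f n) - 0\<bar> \<le> \<epsilon>)"
          by (rule with_o1I[OF eS], rule impI, frule (1) S_odd, frule eq, simp)
        show "with_o1 \<delta> (\<lambda>n r \<epsilon>. odd r \<longrightarrow>
            \<bar>BStab n r (f n) - 2 * (r / n) * Stab n (r / n) (f n)\<bar> \<le> \<epsilon>)"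
          unfolding twice by (rule with_o1I[OF eB], rule impI, frule (1) B_odd, frule PQ, simp)
      qed
    qed
    show "?stable \<longrightarrow> ?R"
    proof
      assume ?stable
      then obtain eD where eD: "eD \<longlonglongrightarrow> 0" and van:
        "\<And>n r. real r / real n \<in> {\<delta>..1/2 - \<delta>} \<Longrightarrow> \<bar>dual_stab n (r / n) (f n)\<bar> \<le> eD n"
        using dual_stab_vanishes[OF delta M] by blast
      \<comment> \<open>The asymptotic formulas differ from \<open>Stab\<close> by
        \<open>dual_stab\<close> for spheres and by \<open>P\<close>, which lies between 0 and
        \<open>dual_stab\<close>, for balls; so the two errors add.\<close>
      have eSD: "(\<lambda>n. eS n + eD n) \<longlonglongrightarrow> 0" and eBD: "(\<lambda>n. eB n + eD n) \<longlonglongrightarrow> 0"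
        using tendsto_add[OF eS eD] tendsto_add[OF eB eD] by simp_all
      show ?R
      proof (intro conjI)
        show "with_o1 \<delta> (\<lambda>n r \<epsilon>. even r \<longrightarrow> \<bar>SStab n r (f n) - Stab n (r / n) (f n)\<bar> \<le> \<epsilon>)"
          by (rule with_o1I[OF eSD], rule impI, frule (1) S_even, frule D(1), frule van, linarith)
        show "with_o1 \<delta> (\<lambda>n r \<epsilon>. even r \<longrightarrow> \<bar>BStab n r (f n) - Stab n (r / n) (f n)\<bar> \<le> \<epsilon>)"
          by (rule with_o1I[OF eBD], rule impI, frule (1) B_even, frule D(3), frule D(5), frule van, linarith)
        show "with_o1 \<delta> (\<lambda>n r \<epsilon>. odd r \<longrightarrow> \<bar>SStab n r (f n) - Stab n (r / n) (f n)\<bar> \<le> \<epsilon>)"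
          by (rule with_o1I[OF eSD], rule impI, frule (1) S_odd, frule D(1), frule van, linarith)
        show "with_o1 \<delta> (\<lambda>n r \<epsilon>. odd r \<longrightarrow> \<bar>BStab n r (f n) - Stab n (r / n) (f n)\<bar> \<le> \<epsilon>)"
          by (rule with_o1I[OF eBD], rule impI, frule (1) B_odd, frule D(3), frule D(5), frule van, linarith)
      qed
    qed
    show "\<forall>T a. (\<forall>n. T n \<subseteq> {..<n} \<and> a n \<in> cube n) \<longrightarrow>
        fourier_weight_stable (\<lambda>n. indicat_real (subcube n (T n) (a n)))"
      using fourier_weight_stable_subcube by blast
    show "\<forall>c \<rho>. (\<forall>n. c n \<in> cube n) \<longrightarrow>
        fourier_weight_stable (\<lambda>n. indicat_real (hball n (c n) (\<rho> n)))"
      using fourier_weight_stable_hball by blast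
  qed
qed

end
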